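(* For every $\gamma>1$ there is a constant $C(\gamma)>0$, depending only on $\gamma$, such that the following holds. Let $0<T<\infty$ and let $(\rho,u)$ be an entropy-admissible weak solution on $S_T$ of the compressible Euler equations with pressure $p(\rho)=\gamma^{-1}\rho^\gamma$ and initial data $(\rho_0,u_0)$ (in the sense defined in the context). Assume $\|\rho^{-1}\|_{L^\infty(S_T)}<\infty$ and let $m>0$ satisfy $$\|\rho^{-1}(\rho-1)\|_{L^\infty(S_T)}+\|u\|_{L^\infty(S_T)}\le m.$$ Let $V\subset\mathbb{R}^3$ be a nonempty, closed, and bounded set with Lipschitz boundary. For $0<\alpha\le1$ define $$d_\alpha(t,x)=\bigl(\operatorname{dist}(x,\mathbb{R}^3\setminus V)-t/\alpha\bigr)_+,\quad (t,x)\in S_T,\qquad V_\alpha=\operatorname{supp}d_\alpha\cap S_T,$$ and define the bounded, nondecreasing, left-continuous function $$F(\alpha;V)=\|\rho^{-1}(\rho-1)\|_{L^\infty(V_\alpha)}+\|u\|_{L^\infty(V_\alpha)},\qquad 0<\alpha\le1,$$ and set $$F(0;V)=\|\rho_0^{-1}(\rho_0-1)\|_{L^\infty(V)}+\|u_0\|_{L^\infty(V)}.$$ If the initial data is such that $F(0;V)=0$, then $$\alpha(V):=\sup\{0\le\alpha\le1:F(\alpha;V)=0\}\ \ge\ (1+C(\gamma)m)^{-1}.$$ Furthermore, if $\alpha(V)<1$, then $$F(\alpha;V)\ \ge\ F(\alpha(V)^+;V)\ >\ 0,\qquad \alpha(V)<\alpha\le1,$$ where $F(\alpha(V)^+;V)$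 denotes the right-hand limit of $F(\cdot;V)$ at $\alpha(V)$. Finally, under the assumption $F(0;V)=0$, if for some $0<\alpha\le1$ the weak solution $(\rho,u)$ admits a continuous representative on $V_\alpha$, then the disturbance vanishes a.e. in $V_\alpha$, i.e. $(\rho-1,u)=(0,0)$ a.e. in $V_\alpha$.
   Context: For $0<T<\infty$ set $S_T=[0,T)\times\mathbb{R}^3$. The compressible Euler equations are $\partial_t\rho+\nabla\cdot(\rho u)=0$, $\partial_t(\rho u)+\nabla\cdot(\rho u\otimes u)+\nabla p(\rho)=0$, with $p(\rho)=\gamma^{-1}\rho^\gamma$, $\gamma>1$. The background density is $1$, with sound speed $p'(1)^{1/2}=1$. Weak solution: $(\rho,u)$ is a weak solution on $S_T$ with initial data $(\rho_0,u_0)$ if $(\rho,u)\in L^\infty(S_T;\mathbb{R}_{>0}\times\mathbb{R}^3)$, $(\rho_0,u_0)\in L^\infty(\mathbb{R}^3;\mathbb{R}_{>0}\times\mathbb{R}^3)$ (positivity of $\rho,\rho_0$ is understood almost everywhere), and $$\iint_{S_T}(\rho\,\partial_t\varphi+\rho u\cdot\nabla_x\varphi)\,dx\,dt+\int_{\mathbb{R}^3}\rho_0\,\varphi(0,\cdot)\,dx=0,$$ $$\iint_{S_T}\bigl(\rho u\cdot\partial_t\psi+\rho\langle u\otimes u,\nabla_x\psi\rangle+\tfrac1\gamma\rho^\gamma\,\nabla_x\cdot\psi\bigr)dx\,dt+\int_{\mathbb{R}^3}\rho_0u_0\cdot\psi(0,\cdot)\,dx=0$$ for all $(\varphi,\psi)\in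 C^{0,1}_0(S_T;\mathbb{R}\times\mathbb{R}^3)$, i.e. all Lipschitz pairs with compact support in $S_T=[0,T)\times\mathbb{R}^3$ (so they need not vanish at $t=0$). Entropy-admissible: a weak solution is entropy-admissible if in addition $$\iint_{S_T}\Bigl[\bigl(\tfrac12\rho|u|^2+\tfrac1{\gamma(\gamma-1)}\rho^\gamma\bigr)\partial_t\varphi+\bigl(\tfrac12\rho|u|^2+\tfrac1{\gamma-1}\rho^\gamma\bigr)u\cdot\nabla_x\varphi\Bigr]dx\,dt+\int_{\mathbb{R}^3}\bigl(\tfrac12\rho_0|u_0|^2+\tfrac1{\gamma(\gamma-1)}\rho_0^\gamma\bigr)\varphi(0,\cdot)\,dx\ \ge\ 0$$ for all nonnegative $\varphi\in C^{0,1}_0(S_T;\mathbb{R}_{\ge0})$ (compactly supported Lipschitz). *)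

theory Defs
  imports "HOL-Analysis.Analysis" "HOL-Probability.Essential_Supremum"
begin

type_synonym space = "real ^ 3"
type_synonym spacetime = "real \<times> space"

definition slab :: "real \<Rightarrow> spacetime set" where
  "slab T = {0..<T} \<times> UNIV"

text \<open>The essential supremum is taken in \<^typ>\<open>ennreal\<close>, so the norm is \<open>\<infinity>\<close> for an
  essentially unbounded function and \<open>0\<close> (not \<open>-\<infinity>\<close>) on a null set.\<close>

definition Linf_norm :: "'a::euclidean_space set \<Rightarrow> ('a \<Rightarrow> 'b::real_normed_vector) \<Rightarrow> ennreal" where
  "Linf_norm A f = esssup (lebesgue_on A) (\<lambda>z. ennreal (norm (f z)))"

definition Linf :: "'a::euclidean_space set \<Rightarrow> ('a \<Rightarrow> 'b::real_normed_vector) set" where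
  "Linf A = {f \<in> borel_measurable (lebesgue_on A). Linf_norm A f < \<infinity>}"

text \<open>Partial derivatives. For Lipschitz \<open>f\<close> they exist almost everywhere; the arbitrary values
  elsewhere do not matter, since the integrals below are taken with respect to the complete
  measure \<^term>\<open>lebesgue\<close>.\<close>

definition d_t :: "(spacetime \<Rightarrow> 'b::real_normed_vector) \<Rightarrow> spacetime \<Rightarrow> 'b" where
  "d_t f z = vector_derivative (\<lambda>s. f (s, snd z)) (at (fst z))"

definition d_x :: "3 \<Rightarrow> (spacetime \<Rightarrow> 'b::real_normed_vector) \<Rightarrow> spacetime \<Rightarrow> 'b" where
  "d_x i f z = vector_derivative (\<lambda>h. f (fst z, snd z + h *\<^sub>R axis i 1)) (at 0)"

definition grad_x :: "(spacetime \<Rightarrow> real) \<Rightarrow> spacetime \<Rightarrow> space" where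
  "grad_x f z = (\<chi> i. d_x i f z)"

definition div_x :: "(spacetime \<Rightarrow> space) \<Rightarrow> spacetime \<Rightarrow> real" where
  "div_x f z = (\<Sum>i\<in>UNIV. d_x i f z $ i)"

text \<open>The pairing of \<open>v \<otimes> v\<close> with the Jacobian of \<open>f\<close> in \<open>x\<close>.\<close>

definition tensor_grad_x :: "space \<Rightarrow> (spacetime \<Rightarrow> space) \<Rightarrow> spacetime \<Rightarrow> real" where
  "tensor_grad_x v f z = (\<Sum>i\<in>UNIV. \<Sum>j\<in>UNIV. v $ i * v $ j * (d_x j f z $ i))"

text \<open>Lipschitz functions on \<^term>\<open>slab T\<close> with compact support in \<^term>\<open>slab T\<close>; the support may
  meet \<open>t = 0\<close>, but stays away from \<open>t = T\<close>. Values outside \<^term>\<open>slab T\<close> are irrelevant.\<close>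

definition test_functions :: "real \<Rightarrow> (spacetime \<Rightarrow> 'b::real_normed_vector) set" where
  "test_functions T = {f. (\<exists>L. L-lipschitz_on (slab T) f) \<and>
     compact (closure (support_on (slab T) f)) \<and> closure (support_on (slab T) f) \<subseteq> slab T}"

definition weak_solution ::
  "real \<Rightarrow> real \<Rightarrow> (spacetime \<Rightarrow> real) \<Rightarrow> (spacetime \<Rightarrow> space) \<Rightarrow> (space \<Rightarrow> real) \<Rightarrow> (space \<Rightarrow> space) \<Rightarrow> bool"
where
  "weak_solution \<gamma> T \<rho> u \<rho>0 u0 \<longleftrightarrow>
     \<rho> \<in> Linf (slab T) \<and> (AE z in lebesgue_on (slab T). \<rho> z > 0) \<and> u \<in> Linf (slab T) \<and>
     \<rho>0 \<in> Linf UNIV \<and> (AE x in lebesgue. \<rho>0 x > 0) \<and> u0 \<in> Linf UNIV \<and>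
     (\<forall>\<phi>\<in>test_functions T.
        (LINT z:slab T|lebesgue. \<rho> z * d_t \<phi> z + \<rho> z * (u z \<bullet> grad_x \<phi> z))
        + (LINT x|lebesgue. \<rho>0 x * \<phi> (0, x)) = 0) \<and>
     (\<forall>\<psi>\<in>test_functions T.
        (LINT z:slab T|lebesgue. \<rho> z * (u z \<bullet> d_t \<psi> z) + \<rho> z * tensor_grad_x (u z) \<psi> z
           + (1 / \<gamma>) * \<rho> z powr \<gamma> * div_x \<psi> z)
        + (LINT x|lebesgue. \<rho>0 x * (u0 x \<bullet> \<psi> (0, x))) = 0)"

definition entropy_admissible ::
  "real \<Rightarrow> real \<Rightarrow> (spacetime \<Rightarrow> real) \<Rightarrow> (spacetime \<Rightarrow> space) \<Rightarrow> (space \<Rightarrow> real) \<Rightarrow> (space \<Rightarrow> space) \<Rightarrow> bool"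
where
  "entropy_admissible \<gamma> T \<rho> u \<rho>0 u0 \<longleftrightarrow>
     weak_solution \<gamma> T \<rho> u \<rho>0 u0 \<and>
     (\<forall>\<phi>\<in>test_functions T. (\<forall>z\<in>slab T. 0 \<le> \<phi> z) \<longrightarrow>
        (LINT z:slab T|lebesgue.
           (1/2 * \<rho> z * (norm (u z))\<^sup>2 + 1 / (\<gamma> * (\<gamma> - 1)) * \<rho> z powr \<gamma>) * d_t \<phi> z
           + (1/2 * \<rho> z * (norm (u z))\<^sup>2 + 1 / (\<gamma> - 1) * \<rho> z powr \<gamma>) * (u z \<bullet> grad_x \<phi> z))
        + (LINT x|lebesgue.
             (1/2 * \<rho>0 x * (norm (u0 x))\<^sup>2 + 1 / (\<gamma> * (\<gamma> - 1)) * \<rho>0 x powr \<gamma>) * \<phi> (0, x)) \<ge> 0)"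

text \<open>Near each boundary point the closed set \<open>V\<close> is the region on one side of the graph, over the
  hyperplane orthogonal to a unit vector \<open>e\<close>, of a Lipschitz function \<open>g\<close>.\<close>

definition lipschitz_boundary :: "'a::euclidean_space set \<Rightarrow> bool" where
  "lipschitz_boundary V \<longleftrightarrow>
     (\<forall>p\<in>frontier V. \<exists>r>0. \<exists>e g L. norm e = 1 \<and> L-lipschitz_on {y. y \<bullet> e = 0} g \<and>
        (\<forall>x\<in>ball p r. x \<in> V \<longleftrightarrow> x \<bullet> e \<le> g (x - (x \<bullet> e) *\<^sub>R e)))"

definition cone_dist :: "space set \<Rightarrow> real \<Rightarrow> spacetime \<Rightarrow> real" where
  "cone_dist V \<alpha> = (\<lambda>(t, x). max 0 (infdist x (- V) - t / \<alpha>))"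

definition cone_region :: "real \<Rightarrow> space set \<Rightarrow> real \<Rightarrow> spacetime set" where
  "cone_region T V \<alpha> = closure (support_on (slab T) (cone_dist V \<alpha>)) \<inter> slab T"

definition disturbance ::
  "real \<Rightarrow> (spacetime \<Rightarrow> real) \<Rightarrow> (spacetime \<Rightarrow> space) \<Rightarrow> (space \<Rightarrow> real) \<Rightarrow> (space \<Rightarrow> space) \<Rightarrow>
     space set \<Rightarrow> real \<Rightarrow> ennreal"
where
  "disturbance T \<rho> u \<rho>0 u0 V \<alpha> =
     (if \<alpha> = 0
      then Linf_norm V (\<lambda>x. inverse (\<rho>0 x) * (\<rho>0 x - 1)) + Linf_norm V u0
      else Linf_norm (cone_region T V \<alpha>) (\<lambda>z. inverse (\<rho> z) * (\<rho> z - 1))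
           + Linf_norm (cone_region T V \<alpha>) u)"

definition vanishing_speed :: "(real \<Rightarrow> ennreal) \<Rightarrow> real" where
  "vanishing_speed F = Sup {\<alpha>. 0 \<le> \<alpha> \<and> \<alpha> \<le> 1 \<and> F \<alpha> = 0}"

definition has_continuous_representative ::
  "'a::euclidean_space set \<Rightarrow> ('a \<Rightarrow> 'b::real_normed_vector) \<Rightarrow> bool" where
  "has_continuous_representative A f \<longleftrightarrow>
     (\<exists>g. continuous_on A g \<and> (AE z in lebesgue_on A. f z = g z))"

end

theory Submission
  imports Defs
begin

text \<open>The solution is compared with the rest state \<open>(1, 0)\<close> through the relative energy
  \<open>\<eta> = \<rho>|u|\<^sup>2/2 + (\<rho>\<^sup>\<gamma> - 1 - \<gamma>(\<rho> - 1)) / (\<gamma>(\<gamma> - 1))\<close>, which is nonnegative and vanishes only at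
  \<open>(1, 0)\<close>. Subtracting the mass balance, and the trivial balance of a constant density, from the
  entropy inequality gives the same inequality for \<open>\<eta>\<close> and its flux \<open>q\<close>
  (\<open>relative_energy_inequality\<close>). The disturbance can only travel as fast as \<open>|q| / \<eta>\<close> allows, and this ratio is at most
  the background sound speed \<open>1\<close> up to a first-order error:
  \<open>|q| \<le> (1 + C (|\<rho>\<^sup>-\<^sup>1(\<rho> - 1)| + |u|)) \<eta>\<close> with \<open>C\<close> depending on \<open>\<gamma>\<close> only (\<open>rel_flux_le_rel_energy\<close>).

  The inequality is tested with a function supported in a backward cone \<open>|x - x\<^sub>0| < R - t/\<beta>\<close> over a ball
  on which the data are at rest. Its time slope is \<open>1/\<beta>\<close> times a bound for its space slope, so
  the outcome is \<open>\<integral> w (|q| - \<eta>/\<beta>) \<ge> 0\<close> with a weight \<open>w\<close> that is positive in a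
  slightly smaller cone and zero outside. If the
  disturbance is at most \<open>\<epsilon>\<close> there and \<open>\<beta> (1 + C \<epsilon>) < 1\<close>, the integrand is at most a negative multiple of
  \<open>w \<eta>\<close>, hence \<open>\<eta> = 0\<close> a.e. in the cone (\<open>cone_disturbance_vanishes\<close>). Up to a null set, the region
  below the graph of \<open>\<alpha> dist(x, - V)\<close> is a union of such cones (\<open>AE_cone_region_if_cones\<close>), so the
  same implication holds for the region of \<open>V\<close> (\<open>region_vanishes_if_small\<close>).

  Everything follows from this one implication. With \<open>\<epsilon> = m\<close> it gives the lower bound for the
  vanishing speed. If the right limit at the vanishing speed \<open>a < 1\<close> were \<open>0\<close>, then \<open>\<epsilon>\<close> could be
  chosen so small that the implication applies just above \<open>a\<close>, contradicting the
  maximality of \<open>a\<close>. For a continuous solution, uniform continuity on a compact cone makes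
  the disturbance small in every cone slightly wider than one in which it vanishes; the admissible widening
  factor is fixed, so finitely many steps reach every speed below \<open>\<alpha>\<close>
  (\<open>continuous_cone_vanishes\<close>).\<close>

section \<open>Relative energy and relative flux\<close>

text \<open>The internal energy \<open>r\<^sup>\<gamma> / (\<gamma>(\<gamma> - 1))\<close> minus its tangent at \<open>r = 1\<close>; hence a convex function with
  second derivative \<open>r\<^sup>\<gamma>\<^sup>-\<^sup>2\<close> and a double zero at \<open>1\<close>.\<close>

definition potential :: "real \<Rightarrow> real \<Rightarrow> real" where
  "potential \<gamma> r = (r powr \<gamma> - 1 - \<gamma> * (r - 1)) / (\<gamma> * (\<gamma> - 1))"

lemma potential_1 [simp]: "potential \<gamma> 1 = 0"
  by (simp add: potential_def)

lemma DERIV_potential: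
  assumes "\<gamma> > 1" "t > 0"
  shows "(potential \<gamma> has_real_derivative (t powr (\<gamma> - 1) - 1) / (\<gamma> - 1)) (at t)"
  unfolding potential_def[abs_def] using assms
  by (auto intro!: derivative_eq_intros simp: divide_simps) (simp add: algebra_simps)

lemma DERIV_potential':
  assumes "\<gamma> > 1" "t > 0"
  shows "((\<lambda>t. (t powr (\<gamma> - 1) - 1) / (\<gamma> - 1)) has_real_derivative t powr (\<gamma> - 2)) (at t)"
  using assms by (auto intro!: derivative_eq_intros simp: divide_simps)

lemma potential_taylor:
  assumes "\<gamma> > 1" "r > 0" "r \<noteq> 1"
  obtains \<xi> where "\<xi> > 0" "\<bar>\<xi> - 1\<bar> \<le> \<bar>r - 1\<bar>" "potential \<gamma> r = \<xi> powr (\<gamma> - 2) * (r - 1)\<^sup>2 / 2"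
proof -
  define D where "D = (\<lambda>(n::nat) r. if n = 0 then potential \<gamma> r
    else if n = 1 then (r powr (\<gamma> - 1) - 1) / (\<gamma> - 1) else r powr (\<gamma> - 2))"
  define a where "a = min r 1"
  define b where "b = max r 1"
  have D: "D 0 = potential \<gamma>" "D 1 = (\<lambda>t. (t powr (\<gamma> - 1) - 1) / (\<gamma> - 1))" "D 2 = (\<lambda>t. t powr (\<gamma> - 2))"
    by (auto simp: D_def)
  have D0: "(D 0 has_real_derivative D 1 t) (at t)" if "t > 0" for t
    unfolding D by (rule DERIV_potential[OF assms(1) that])
  have D1: "(D 1 has_real_derivative D 2 t) (at t)" if "t > 0" for t
    unfolding D by (rule DERIV_potential'[OF assms(1) that])
  have "\<exists>t. (if r < 1 then r < t \<and> t < 1 else 1 < t \<and> t < r) \<and>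
      potential \<gamma> r = (\<Sum>m<2. (D m 1 / fact m) * (r - 1)^m) + (D 2 t / fact 2) * (r - 1)^2"
  proof (rule Taylor[where a = a and b = b])
    show "\<forall>m t. m < 2 \<and> a \<le> t \<and> t \<le> b \<longrightarrow> DERIV (D m) t :> D (Suc m) t"
    proof (intro allI impI)
      fix m :: nat and t assume H: "m < 2 \<and> a \<le> t \<and> t \<le> b"
      then have "t > 0" "m = 0 \<or> m = 1" using assms by (auto simp: a_def)
      then show "DERIV (D m) t :> D (Suc m) t"
        using D0 D1 by (auto simp: numeral_2_eq_2)
    qed
  qed (use assms in \<open>auto simp: a_def b_def D_def\<close>)
  then obtain t where t: "if r < 1 then r < t \<and> t < 1 else 1 < t \<and> t < r"
    and eq: "potential \<gamma> r = (\<Sum>m<2. (D m 1 / fact m) * (r - 1)^m) + (D 2 t / fact 2) * (r - 1)^2"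
    by blast
  show thesis
  proof (rule that[of t])
    show "t > 0" "\<bar>t - 1\<bar> \<le> \<bar>r - 1\<bar>" using t assms by (auto split: if_splits)
    show "potential \<gamma> r = t powr (\<gamma> - 2) * (r - 1)\<^sup>2 / 2"
      using eq by (simp add: D_def numeral_2_eq_2 lessThan_Suc)
  qed
qed

lemma potential_pos: "\<gamma> > 1 \<Longrightarrow> r > 0 \<Longrightarrow> r \<noteq> 1 \<Longrightarrow> potential \<gamma> r > 0"
proof -
  assume "\<gamma> > 1" "r > 0" "r \<noteq> 1"
  then obtain \<xi> where "\<xi> > 0" and eq: "potential \<gamma> r = \<xi> powr (\<gamma> - 2) * (r - 1)\<^sup>2 / 2"
    by (rule potential_taylor)
  with \<open>r \<noteq> 1\<close> have "\<xi> powr (\<gamma> - 2) * (r - 1)\<^sup>2 / 2 > 0" by simp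
  then show "potential \<gamma> r > 0" by (simp only: eq)
qed

lemma potential_nonneg: "\<gamma> > 1 \<Longrightarrow> r > 0 \<Longrightarrow> potential \<gamma> r \<ge> 0"
  using potential_pos[of \<gamma> r] by (cases "r = 1") (auto intro: less_imp_le)

lemma potential_convex:
  assumes "\<gamma> > 1" shows "convex_on {0<..} (potential \<gamma>)"
  by (rule f''_ge0_imp_convex[OF _ DERIV_potential DERIV_potential']) (use assms in auto)

text \<open>Away from its zero a convex function grows at least linearly: its slope from \<open>1\<close> to \<open>r\<close>
  dominates the slope from \<open>1\<close> to the intermediate point at distance \<open>1/2\<close>.\<close>

lemma potential_linear_growth:
  assumes "\<gamma> > 1"
  obtains K where "K > 0" "\<And>r. r > 0 \<Longrightarrow> \<bar>r - 1\<bar> \<ge> 1/2 \<Longrightarrow> \<bar>r - 1\<bar> \<le> K * potential \<gamma> r"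
proof -
  define c where "c = min (potential \<gamma> (1/2)) (potential \<gamma> (3/2))"
  have c: "c > 0" using potential_pos[OF assms, of "1/2"] potential_pos[OF assms, of "3/2"] by (simp add: c_def)
  show thesis
  proof (rule that[of "1 / c"])
    fix r :: real assume r: "r > 0" "\<bar>r - 1\<bar> \<ge> 1/2"
    define l where "l = (1/2) / \<bar>r - 1\<bar>"
    define b where "b = (1 - l) * 1 + l * r"
    have l: "0 \<le> l" "l \<le> 1" "l * \<bar>r - 1\<bar> = 1/2" using r by (auto simp: l_def divide_le_eq_1)
    have b: "b = 1/2 \<or> b = 3/2"
      using l(3) unfolding b_def by (cases "r \<ge> 1") (auto simp: algebra_simps)
    have "potential \<gamma> b \<le> (1 - l) * potential \<gamma> 1 + l * potential \<gamma> r"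
      using convex_onD[OF potential_convex[OF assms], of l 1 r] l r by (simp add: b_def)
    moreover have "c \<le> potential \<gamma> b" using b by (metis c_def min.cobounded1 min.cobounded2)
    ultimately have "c \<le> l * potential \<gamma> r" by simp
    then have "c * \<bar>r - 1\<bar> \<le> (l * \<bar>r - 1\<bar>) * potential \<gamma> r"
      by (metis abs_ge_zero mult.assoc mult.commute mult_left_mono)
    then have "c * \<bar>r - 1\<bar> \<le> potential \<gamma> r / 2" using l by simp
    also have "\<dots> \<le> potential \<gamma> r" using potential_nonneg[OF assms r(1)] by simp
    finally show "\<bar>r - 1\<bar> \<le> 1 / c * potential \<gamma> r" using c by (simp add: field_simps)
  qed (use c in simp)
qed

text \<open>Near \<open>1\<close> the potential is half of \<open>(r - 1)\<^sup>2\<close> up to a third-order error. The coefficient \<open>2\<close> is sharp;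
  it makes the leading propagation speed exactly the sound speed \<open>1\<close>.\<close>

lemma potential_quadratic_growth:
  assumes "\<gamma> > 1"
  obtains K where "K > 0"
    "\<And>r. r > 0 \<Longrightarrow> \<bar>r - 1\<bar> \<le> 1/2 \<Longrightarrow> (r - 1)\<^sup>2 \<le> 2 * (1 + K * \<bar>r - 1\<bar>) * potential \<gamma> r"
proof -
  define K where "K = 1 + \<bar>2 - \<gamma>\<bar> * (1/2) powr (1 - \<gamma>)"
  have "(r - 1)\<^sup>2 \<le> 2 * (1 + K * \<bar>r - 1\<bar>) * potential \<gamma> r" if r: "r > 0" "\<bar>r - 1\<bar> \<le> 1/2" "r \<noteq> 1" for r
  proof -
    obtain \<xi> where \<xi>: "\<xi> > 0" "\<bar>\<xi> - 1\<bar> \<le> \<bar>r - 1\<bar>" "potential \<gamma> r = \<xi> powr (\<gamma> - 2) * (r - 1)\<^sup>2 / 2"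
      using potential_taylor[OF assms r(1,3)] .
    have "norm (\<xi> powr (2 - \<gamma>) - 1 powr (2 - \<gamma>)) \<le> \<bar>2 - \<gamma>\<bar> * (1/2) powr (1 - \<gamma>) * norm (\<xi> - 1)"
    proof (rule field_differentiable_bound[where S = "{1/2..3/2}"])
      fix z :: real assume z: "z \<in> {1/2..3/2}"
      then show "((\<lambda>z. z powr (2 - \<gamma>)) has_field_derivative (2 - \<gamma>) * z powr (1 - \<gamma>)) (at z within {1/2..3/2})"
        by (auto intro!: derivative_eq_intros)
      show "norm ((2 - \<gamma>) * z powr (1 - \<gamma>)) \<le> \<bar>2 - \<gamma>\<bar> * (1/2) powr (1 - \<gamma>)"
        using z assms by (auto simp: abs_mult intro!: mult_left_mono powr_mono2')
    qed (use \<xi> r in \<open>auto simp: abs_if split: if_splits\<close>)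
    also have "\<dots> \<le> K * \<bar>r - 1\<bar>"
      using \<xi>(2) by (auto simp: K_def intro!: mult_mono)
    finally have 1: "\<xi> powr (2 - \<gamma>) \<le> 1 + K * \<bar>r - 1\<bar>" by (simp add: abs_if split: if_splits)
    have "(r - 1)\<^sup>2 = 2 * \<xi> powr (2 - \<gamma>) * potential \<gamma> r"
    proof -
      have "\<xi> powr (2 - \<gamma>) * \<xi> powr (\<gamma> - 2) = 1" using \<xi>(1) by (simp flip: powr_add)
      then show ?thesis unfolding \<xi>(3) by (simp add: mult.assoc[symmetric])
    qed
    also have "\<dots> \<le> 2 * (1 + K * \<bar>r - 1\<bar>) * potential \<gamma> r"
      using 1 potential_nonneg[OF assms r(1)] by (intro mult_right_mono) auto
    finally show ?thesis .
  qed
  moreover have "K > 0" by (simp add: K_def add_pos_nonneg)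
  ultimately show thesis
    by (intro that[of K]) (metis diff_self mult_zero_right potential_1 order_refl power_zero_numeral)+
qed

definition rel_energy :: "real \<Rightarrow> real \<Rightarrow> space \<Rightarrow> real" where
  "rel_energy \<gamma> r v = 1/2 * r * (norm v)\<^sup>2 + potential \<gamma> r"

text \<open>The energy flux minus \<open>1/(\<gamma> - 1)\<close> times the mass flux \<open>r v\<close>, that is, the flux paired with
  the relative energy.\<close>

definition rel_flux :: "real \<Rightarrow> real \<Rightarrow> space \<Rightarrow> space" where
  "rel_flux \<gamma> r v = (1/2 * r * (norm v)\<^sup>2 + (r powr \<gamma> - r) / (\<gamma> - 1)) *\<^sub>R v"

lemma rel_energy_nonneg: "\<gamma> > 1 \<Longrightarrow> r > 0 \<Longrightarrow> rel_energy \<gamma> r v \<ge> 0"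
  by (simp add: rel_energy_def potential_nonneg)

lemma rel_energy_eq_0_iff:
  assumes "\<gamma> > 1" "r > 0"
  shows "rel_energy \<gamma> r v = 0 \<longleftrightarrow> r = 1 \<and> v = 0"
proof
  assume 0: "rel_energy \<gamma> r v = 0"
  have "1/2 * r * (norm v)\<^sup>2 \<ge> 0" "potential \<gamma> r \<ge> 0" using assms by (auto simp: potential_nonneg)
  with 0 have "1/2 * r * (norm v)\<^sup>2 = 0" "potential \<gamma> r = 0" unfolding rel_energy_def by linarith+
  then show "r = 1 \<and> v = 0" using assms potential_pos[OF assms] by fastforce
qed (simp add: rel_energy_def)

text \<open>Since \<open>(r\<^sup>\<gamma> - r)/(\<gamma> - 1) = \<gamma> h + (r - 1)\<close> with \<open>h\<close> the potential, all of the flux except \<open>(r - 1) v\<close>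
  is \<open>O(|v|)\<close> times the energy. The remaining term is the acoustic one. For \<open>|r - 1| \<le> 1/2\<close>,
  \<open>|r - 1| |v| \<le> r|v|\<^sup>2/2 + (r - 1)\<^sup>2/(2r)\<close>, and the quadratic growth of the potential bounds this
  by the energy with constant \<open>1\<close> plus a first-order correction. For larger \<open>|r - 1|\<close> linear growth
  suffices, and it is what keeps \<open>C\<close> independent of the size of \<open>r\<close>.\<close>

lemma rel_flux_le_rel_energy:
  assumes "\<gamma> > 1"
  obtains C where "C > 0"
    "\<And>r v. r > 0 \<Longrightarrow> norm (rel_flux \<gamma> r v) \<le> (1 + C * (\<bar>inverse r * (r - 1)\<bar> + norm v)) * rel_energy \<gamma> r v"
proof -
  obtain K where K: "K > 0" "\<And>r. r > 0 \<Longrightarrow> \<bar>r - 1\<bar> \<ge> 1/2 \<Longrightarrow> \<bar>r - 1\<bar> \<le> K * potential \<gamma> r"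
    using potential_linear_growth[OF assms] by blast
  obtain L where L: "L > 0"
    "\<And>r. r > 0 \<Longrightarrow> \<bar>r - 1\<bar> \<le> 1/2 \<Longrightarrow> (r - 1)\<^sup>2 \<le> 2 * (1 + L * \<bar>r - 1\<bar>) * potential \<gamma> r"
    using potential_quadratic_growth[OF assms] by blast
  define C where "C = \<gamma> + K + (1 + L)"
  show thesis
  proof (rule that[of C])
    show "C > 0" using assms K L by (simp add: C_def)
    fix r :: real and v :: space assume r: "r > 0"
    define h where "h = potential \<gamma> r"
    define e where "e = rel_energy \<gamma> r v"
    define s where "s = \<bar>inverse r * (r - 1)\<bar>"
    define w where "w = norm v"
    have nn: "h \<ge> 0" "e \<ge> h" "w \<ge> 0" "s \<ge> 0"
      using potential_nonneg[OF assms r] r by (auto simp: h_def e_def rel_energy_def s_def w_def)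
    have e_eq: "e = 1/2 * r * w\<^sup>2 + h" by (simp add: e_def rel_energy_def h_def w_def)
    have rw: "0 \<le> 1/2 * r * w\<^sup>2" using r by simp
    have pres: "(r powr \<gamma> - r) / (\<gamma> - 1) = \<gamma> * h + (r - 1)"
      using assms by (simp add: h_def potential_def field_simps)
    have "norm (rel_flux \<gamma> r v) = \<bar>1/2 * r * w\<^sup>2 + \<gamma> * h + (r - 1)\<bar> * w"
      unfolding rel_flux_def pres by (simp add: w_def add.assoc)
    also have "\<dots> \<le> (1/2 * r * w\<^sup>2 + \<gamma> * h + \<bar>r - 1\<bar>) * w"
    proof (intro mult_right_mono nn)
      have "0 \<le> \<gamma> * h" using nn assms by (intro mult_nonneg_nonneg) auto
      then show "\<bar>1/2 * r * w\<^sup>2 + \<gamma> * h + (r - 1)\<bar> \<le> 1/2 * r * w\<^sup>2 + \<gamma> * h + \<bar>r - 1\<bar>" using rw by linarith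
    qed
    also have "\<dots> \<le> \<gamma> * e * w + \<bar>r - 1\<bar> * w"
    proof -
      have "1/2 * r * w\<^sup>2 \<le> \<gamma> * (1/2 * r * w\<^sup>2)" using mult_right_mono[of 1 \<gamma>, OF _ rw] assms by simp
      then have le: "1/2 * r * w\<^sup>2 + \<gamma> * h \<le> \<gamma> * e" by (simp add: e_eq algebra_simps)
      show ?thesis using mult_right_mono[OF le nn(3)] by (simp add: distrib_right)
    qed
    also have "\<bar>r - 1\<bar> * w \<le> (1 + (K * w + (1 + L) * s)) * e"
    proof (cases "\<bar>r - 1\<bar> \<ge> 1/2")
      case True
      have "\<bar>r - 1\<bar> * w \<le> (K * h) * w" using K(2)[OF r True] nn by (simp add: h_def mult_right_mono)
      also have "\<dots> \<le> (K * e) * w" using nn K by (simp add: mult_right_mono)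
      also have "\<dots> \<le> (1 + (K * w + (1 + L) * s)) * e" using nn K L by (simp add: algebra_simps)
      finally show ?thesis .
    next
      case False
      have s: "\<bar>r - 1\<bar> = r * s" using r by (simp add: s_def abs_mult)
      \<comment> \<open>replaces the factor 1 in the quadratic growth bound, so that r can be cancelled\<close>
      have ir: "1 \<le> r * (1 + s)" using r s by (auto simp: algebra_simps abs_if split: if_splits)
      have "0 \<le> r * (w - s)\<^sup>2" using r by simp
      then have "\<bar>r - 1\<bar> * w \<le> 1/2 * r * w\<^sup>2 + 1/2 * r * s\<^sup>2"
        by (simp add: s power2_eq_square algebra_simps)
      also have "1/2 * r * s\<^sup>2 \<le> (1 + (1 + L) * s) * h"
      proof -
        have "(r * s)\<^sup>2 = (r - 1)\<^sup>2" using s by (metis power2_abs)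
        also have "\<dots> \<le> 2 * (1 + L * (r * s)) * h" using L(2)[OF r] False by (simp add: s h_def)
        also have "\<dots> \<le> 2 * (r * (1 + s) + L * (r * s)) * h"
          using ir nn by (intro mult_right_mono) auto
        finally have "r * (1/2 * r * s\<^sup>2) \<le> r * ((1 + (1 + L) * s) * h)"
          by (simp add: power2_eq_square algebra_simps)
        then show ?thesis using r by simp
      qed
      also have "1/2 * r * w\<^sup>2 + (1 + (1 + L) * s) * h \<le> (1 + (1 + L) * s) * e"
        using nn r L by (simp add: e_eq algebra_simps)
      also have "\<dots> \<le> (1 + (K * w + (1 + L) * s)) * e" using nn K by (intro mult_right_mono) auto
      finally show ?thesis by simp
    qed
    also have "\<gamma> * e * w + (1 + (K * w + (1 + L) * s)) * e
        = (1 + ((\<gamma> + K) * w + (1 + L) * s)) * e" by (simp add: algebra_simps)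
    also have "\<dots> \<le> (1 + C * (s + w)) * e"
      using nn K L assms by (intro mult_right_mono) (auto simp: C_def algebra_simps)
    finally show "norm (rel_flux \<gamma> r v) \<le> (1 + C * (\<bar>inverse r * (r - 1)\<bar> + norm v)) * rel_energy \<gamma> r v"
      by (simp add: s_def w_def e_def)
  qed
qed

section \<open>Test functions supported in backward cones\<close>

text \<open>The parameter \<open>\<delta>\<close> rounds off the vertex of \<open>|x - x\<^sub>0|\<close>: the norm of the pair \<open>(\<delta>, x - x\<^sub>0)\<close> is smooth in \<open>x\<close>
  for \<open>\<delta> \<noteq> 0\<close>.\<close>

definition cone_height :: "space \<Rightarrow> real \<Rightarrow> real \<Rightarrow> real \<Rightarrow> spacetime \<Rightarrow> real" where
  "cone_height x0 R \<beta> \<delta> z = max 0 (R - fst z / \<beta> - norm (\<delta>, snd z - x0))"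

text \<open>Squaring the truncated height makes the test function continuously differentiable, so that its
  partial derivatives are given by one formula at every point.\<close>

definition cone_test :: "space \<Rightarrow> real \<Rightarrow> real \<Rightarrow> real \<Rightarrow> spacetime \<Rightarrow> real" where
  "cone_test x0 R \<beta> \<delta> z = (cone_height x0 R \<beta> \<delta> z)\<^sup>2"

text \<open>The spatial gradient of the test function divided by the height.\<close>

definition cone_normal :: "space \<Rightarrow> real \<Rightarrow> spacetime \<Rightarrow> space" where
  "cone_normal x0 \<delta> z = (- 2 / norm (\<delta>, snd z - x0)) *\<^sub>R (snd z - x0)"

lemma cone_height_nonneg [simp]: "cone_height x0 R \<beta> \<delta> z \<ge> 0"
  by (simp add: cone_height_def)

lemma continuous_cone_height [continuous_intros]:
  "\<beta> \<noteq> 0 \<Longrightarrow> continuous_on S (cone_height x0 R \<beta> \<delta>)"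
  unfolding cone_height_def[abs_def] by (intro continuous_intros) auto

lemma DERIV_max_0_square:
  "((\<lambda>s::real. (max 0 s)\<^sup>2) has_real_derivative 2 * max 0 s) (at s)"
proof -
  consider "s > 0" | "s < 0" | "s = 0" by linarith
  then show ?thesis
  proof cases
    case 1
    have "((\<lambda>s. s\<^sup>2) has_real_derivative 2 * s) (at s)" by (auto intro!: derivative_eq_intros)
    then show ?thesis using 1
      by (subst DERIV_cong_ev[OF refl _ refl, where g = "\<lambda>s. s\<^sup>2"])
         (auto intro!: eventually_mono[OF eventually_nhds_in_open[of "{0<..}"]])
  next
    case 2
    have "((\<lambda>s. 0) has_real_derivative 0) (at s)" by simp
    then show ?thesis using 2
      by (subst DERIV_cong_ev[OF refl _ refl, where g = "\<lambda>s. 0"])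
         (auto intro!: eventually_mono[OF eventually_nhds_in_open[of "{..<0}"]])
  next
    case 3
    have "((\<lambda>h::real. (max 0 h)\<^sup>2 / h) \<longlongrightarrow> 0) (at 0)"
    proof (rule Lim_null_comparison)
      show "\<forall>\<^sub>F h in at 0. norm ((max 0 h)\<^sup>2 / h) \<le> \<bar>h::real\<bar>"
        by (rule always_eventually) (auto simp: max_def power2_eq_square)
      show "((\<lambda>h::real. \<bar>h\<bar>) \<longlongrightarrow> 0) (at 0)" by (auto intro!: tendsto_eq_intros)
    qed
    then show ?thesis using 3 by (simp add: DERIV_def)
  qed
qed

lemma cone_test_DERIV_t:
  assumes "\<beta> \<noteq> 0"
  shows "((\<lambda>s. cone_test x0 R \<beta> \<delta> (s, x)) has_real_derivative
          - (2 / \<beta>) * cone_height x0 R \<beta> \<delta> (t, x)) (at t)"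
proof -
  have "((\<lambda>s. R - s / \<beta> - norm (\<delta>, x - x0)) has_real_derivative - (1 / \<beta>)) (at t)"
    using assms by (auto intro!: derivative_eq_intros)
  from DERIV_chain2[OF DERIV_max_0_square this] show ?thesis
    by (simp add: cone_test_def cone_height_def mult_ac)
qed

lemma d_t_cone_test:
  "\<beta> \<noteq> 0 \<Longrightarrow> d_t (cone_test x0 R \<beta> \<delta>) z = - (2 / \<beta>) * cone_height x0 R \<beta> \<delta> z"
  unfolding d_t_def
  by (rule vector_derivative_at)
     (use cone_test_DERIV_t[of \<beta> x0 R \<delta> "snd z" "fst z"] in \<open>simp add: has_real_derivative_iff_has_vector_derivative\<close>)

lemma grad_x_cone_test:
  assumes "\<delta> > 0"
  shows "grad_x (cone_test x0 R \<beta> \<delta>) z = cone_height x0 R \<beta> \<delta> z *\<^sub>R cone_normal x0 \<delta> z"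
proof -
  define y where "y = snd z - x0"
  have pos: "\<delta>\<^sup>2 + (norm y)\<^sup>2 > 0" using assms by (simp add: add_pos_nonneg)
  have "d_x i (cone_test x0 R \<beta> \<delta>) z = cone_height x0 R \<beta> \<delta> z * cone_normal x0 \<delta> z $ i" for i
  proof -
    have nrm: "norm (\<delta>, snd z + h *\<^sub>R axis i 1 - x0) = sqrt (\<delta>\<^sup>2 + ((norm y)\<^sup>2 + 2 * h * y $ i + h\<^sup>2))" for h
    proof -
      have "snd z + h *\<^sub>R axis i 1 - x0 = y + h *\<^sub>R axis i 1" by (simp add: y_def)
      moreover have "(norm (y + h *\<^sub>R axis i 1))\<^sup>2 = (norm y)\<^sup>2 + 2 * h * y $ i + h\<^sup>2"
        by (simp only: power2_norm_eq_inner inner_add_left inner_add_right)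
           (simp add: inner_axis inner_axis' inner_axis_axis power2_eq_square algebra_simps)
      ultimately show ?thesis by (simp only: norm_Pair real_norm_def power2_abs)
    qed
    have "((\<lambda>h. sqrt (\<delta>\<^sup>2 + ((norm y)\<^sup>2 + 2 * h * y $ i + h\<^sup>2))) has_real_derivative
        y $ i / sqrt (\<delta>\<^sup>2 + (norm y)\<^sup>2)) (at 0)"
      using pos by (auto intro!: derivative_eq_intros simp: field_simps)
    from DERIV_diff[OF DERIV_const this, of "R - fst z / \<beta>"]
    have "((\<lambda>h. R - fst z / \<beta> - norm (\<delta>, snd z + h *\<^sub>R axis i 1 - x0)) has_real_derivative
        - (y $ i / norm (\<delta>, y))) (at 0)"
      unfolding nrm by (simp add: norm_Pair)
    from DERIV_chain2[OF DERIV_max_0_square this]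
    have "((\<lambda>h. cone_test x0 R \<beta> \<delta> (fst z, snd z + h *\<^sub>R axis i 1)) has_real_derivative
        cone_height x0 R \<beta> \<delta> z * cone_normal x0 \<delta> z $ i) (at 0)"
      by (simp add: cone_test_def cone_height_def cone_normal_def y_def mult_ac left_diff_distrib right_diff_distrib)
    then show ?thesis
      unfolding d_x_def by (intro vector_derivative_at) (simp add: has_real_derivative_iff_has_vector_derivative)
  qed
  then show ?thesis by (simp add: grad_x_def vec_eq_iff)
qed

lemma norm_cone_normal_le: "norm (cone_normal x0 \<delta> z) \<le> 2"
proof (cases "norm (\<delta>, snd z - x0) = 0")
  case False
  then have "norm (snd z - x0) / norm (\<delta>, snd z - x0) \<le> 1"
    using norm_snd_le[of "snd z - x0" \<delta>] by (simp add: divide_le_eq_1)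
  then show ?thesis by (simp add: cone_normal_def)
qed (simp add: cone_normal_def)

lemma continuous_cone_normal [continuous_intros]:
  "\<delta> \<noteq> 0 \<Longrightarrow> continuous_on S (cone_normal x0 \<delta>)"
  unfolding cone_normal_def[abs_def] by (intro continuous_intros) (auto simp: zero_prod_def)

lemma cone_height_le:
  assumes "\<beta> > 0" "R \<ge> 0" "fst z \<ge> 0"
  shows "cone_height x0 R \<beta> \<delta> z \<le> R"
proof -
  have "fst z / \<beta> \<ge> 0" using assms by simp
  moreover have "norm (\<delta>, snd z - x0) \<ge> 0" by simp
  ultimately show ?thesis using assms unfolding cone_height_def by linarith
qed

lemma cone_height_posD:
  assumes "\<beta> > 0" "cone_height x0 R \<beta> \<delta> z > 0" "\<delta> \<ge> 0"
  shows "norm (snd z - x0) < R - fst z / \<beta>" "\<delta> < R - fst z / \<beta>"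
  using norm_snd_le[of "snd z - x0" \<delta>] norm_fst_le[of \<delta> "snd z - x0"] assms
  by (auto simp: cone_height_def)

lemma cone_height_support:
  assumes "\<beta> > 0" "\<delta> > 0" "fst z \<ge> 0" "cone_height x0 R \<beta> \<delta> z \<noteq> 0"
  shows "z \<in> {0..\<beta> * (R - \<delta>)} \<times> cball x0 R"
proof -
  have "cone_height x0 R \<beta> \<delta> z > 0" using assms(4) cone_height_nonneg[of x0 R \<beta> \<delta> z] by linarith
  note D = cone_height_posD[OF assms(1) this]
  have "fst z / \<beta> \<ge> 0" using assms by simp
  then have "norm (snd z - x0) \<le> R" "fst z / \<beta> \<le> R - \<delta>" using D assms(2) by linarith+
  then show ?thesis using assms
    by (cases z) (auto simp: dist_norm norm_minus_commute field_simps)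
qed

lemma cone_test_in_test_functions:
  assumes "\<beta> > 0" "\<delta> > 0" "R > 0" "\<beta> * R \<le> T"
  shows "cone_test x0 R \<beta> \<delta> \<in> test_functions T"
proof -
  let ?K = "{0..\<beta> * (R - \<delta>)} \<times> cball x0 R"
  have sub: "support_on (slab T) (cone_test x0 R \<beta> \<delta>) \<subseteq> ?K"
  proof
    fix z assume "z \<in> support_on (slab T) (cone_test x0 R \<beta> \<delta>)"
    then have "fst z \<ge> 0" "cone_height x0 R \<beta> \<delta> z \<noteq> 0"
      by (auto simp: support_on_def slab_def cone_test_def)
    then show "z \<in> ?K" using cone_height_support assms by blast
  qed
  have K: "compact ?K" by (intro compact_Times) auto
  have cl: "closure (support_on (slab T) (cone_test x0 R \<beta> \<delta>)) \<subseteq> ?K"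
    using closure_minimal[OF sub compact_imp_closed[OF K]] .
  have "\<beta> * (R - \<delta>) < T" using assms by (smt (verit) mult_strict_left_mono)
  then have "?K \<subseteq> slab T" by (auto simp: slab_def)
  moreover have "compact (closure (support_on (slab T) (cone_test x0 R \<beta> \<delta>)))"
    using compact_Int_closed[OF K closed_closure, of "support_on (slab T) (cone_test x0 R \<beta> \<delta>)"] cl
    by (simp add: Int_absorb1)
  moreover have "(2 * R * (1 / \<beta> + 1))-lipschitz_on (slab T) (cone_test x0 R \<beta> \<delta>)"
  proof (rule lipschitz_onI)
    show "0 \<le> 2 * R * (1 / \<beta> + 1)" using assms by simp
    fix z w assume zw: "z \<in> slab T" "w \<in> slab T"
    define a where "a = cone_height x0 R \<beta> \<delta> z"
    define b where "b = cone_height x0 R \<beta> \<delta> w"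
    have ab: "0 \<le> a" "0 \<le> b" "a \<le> R" "b \<le> R"
      using zw assms cone_height_le[of \<beta> R] by (auto simp: a_def b_def slab_def)
    have "\<bar>a - b\<bar> \<le> \<bar>(R - fst z / \<beta> - norm (\<delta>, snd z - x0)) - (R - fst w / \<beta> - norm (\<delta>, snd w - x0))\<bar>"
      by (auto simp: a_def b_def cone_height_def)
    also have "\<dots> \<le> \<bar>fst z / \<beta> - fst w / \<beta>\<bar> + \<bar>norm (\<delta>, snd z - x0) - norm (\<delta>, snd w - x0)\<bar>" by linarith
    also have "\<bar>fst z / \<beta> - fst w / \<beta>\<bar> \<le> 1 / \<beta> * dist z w"
      using dist_fst_le[of z w] assms by (simp add: dist_real_def flip: diff_divide_distrib) (simp add: divide_right_mono)
    also have "\<bar>norm (\<delta>, snd z - x0) - norm (\<delta>, snd w - x0)\<bar> \<le> dist z w"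
    proof -
      have "\<bar>norm (\<delta>, snd z - x0) - norm (\<delta>, snd w - x0)\<bar> \<le> norm ((\<delta>, snd z - x0) - (\<delta>, snd w - x0))"
        by (rule norm_triangle_ineq3)
      also have "\<dots> = dist (snd z) (snd w)" by (simp add: dist_norm norm_Pair)
      finally show ?thesis using dist_snd_le[of z w] by linarith
    qed
    finally have *: "\<bar>a - b\<bar> \<le> (1 / \<beta> + 1) * dist z w" by (simp add: algebra_simps)
    have "dist (a\<^sup>2) (b\<^sup>2) = (a + b) * \<bar>a - b\<bar>"
      using ab by (simp add: dist_real_def power2_eq_square square_diff_square_factored abs_mult)
    also have "\<dots> \<le> (2 * R) * ((1 / \<beta> + 1) * dist z w)" using ab * by (intro mult_mono) auto
    finally show "dist (cone_test x0 R \<beta> \<delta> z) (cone_test x0 R \<beta> \<delta> w) \<le> 2 * R * (1 / \<beta> + 1) * dist z w"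
      by (simp add: a_def b_def cone_test_def mult.assoc)
  qed
  ultimately show ?thesis using cl by (auto simp: test_functions_def)
qed

lemma slab_borel [measurable]: "slab T \<in> sets borel"
  unfolding slab_def by (intro borel_Times) auto

text \<open>The weak mass balance of the constant density \<open>1\<close> at rest, by Fubini and the fundamental theorem of
  calculus in time. It supplies the constant term of the relative energy.\<close>

lemma cone_test_const_state:
  assumes "\<beta> > 0" "\<delta> > 0" "R > 0" "\<beta> * R \<le> T"
  shows "(LINT z:slab T|lebesgue. d_t (cone_test x0 R \<beta> \<delta>) z) + (LINT x|lebesgue. cone_test x0 R \<beta> \<delta> (0, x)) = 0"
proof -
  let ?K = "{0..\<beta> * (R - \<delta>)} \<times> cball x0 R"
  let ?f = "\<lambda>z. indicator (slab T) z *\<^sub>R d_t (cone_test x0 R \<beta> \<delta>) z"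
  have T: "T > 0" using assms by (smt (verit) mult_pos_pos)
  have dt: "d_t (cone_test x0 R \<beta> \<delta>) = (\<lambda>z. - (2 / \<beta>) * cone_height x0 R \<beta> \<delta> z)"
    using assms by (auto simp: d_t_cone_test)
  have [measurable]: "cone_height x0 R \<beta> \<delta> \<in> borel_measurable borel"
    using assms by (intro borel_measurable_continuous_onI continuous_intros) auto
  then have [measurable]: "cone_test x0 R \<beta> \<delta> \<in> borel_measurable borel"
    unfolding cone_test_def[abs_def] by measurable
  have f_meas: "?f \<in> borel_measurable borel" unfolding dt by measurable
  have int: "integrable lborel ?f"
  proof (rule integrableI_bounded_set[where A = ?K and B = "2 / \<beta> * R"])
    have K: "compact ?K" by (intro compact_Times) auto
    show "?K \<in> sets lborel" using compact_imp_closed[OF K] by auto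
    show "emeasure lborel ?K < \<infinity>" using emeasure_bounded_finite[OF compact_imp_bounded[OF K]] .
    show "AE z in lborel. z \<in> ?K \<longrightarrow> norm (?f z) \<le> 2 / \<beta> * R"
      using cone_height_le[of \<beta> R] assms
      by (intro AE_I2 impI) (auto simp: dt indicator_def abs_mult slab_def intro!: divide_right_mono)
    show "AE z in lborel. z \<notin> ?K \<longrightarrow> ?f z = 0"
    proof (intro AE_I2 impI)
      fix z assume "z \<notin> ?K"
      then have "z \<notin> slab T \<or> cone_height x0 R \<beta> \<delta> z = 0"
        using cone_height_support[of \<beta> \<delta> z x0 R] assms by (auto simp: slab_def)
      then show "?f z = 0" by (auto simp: dt)
    qed
  qed (use f_meas in \<open>simp del: real_scaleR_def\<close>)
  have height_0: "cone_height x0 R \<beta> \<delta> (t, x) = 0" if "t \<ge> T" for t x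
  proof -
    have "R \<le> t / \<beta>" using that assms by (simp add: field_simps)
    then show ?thesis by (simp add: cone_height_def) (smt (verit) norm_ge_zero)
  qed
  have inner: "(\<integral>t. ?f (t, x) \<partial>lborel) = - cone_test x0 R \<beta> \<delta> (0, x)" for x
  proof -
    have "(\<integral>t. ?f (t, x) \<partial>lborel) = (\<integral>t. indicator {0..T} t *\<^sub>R (- (2 / \<beta>) * cone_height x0 R \<beta> \<delta> (t, x)) \<partial>lborel)"
      using height_0 by (intro Bochner_Integration.integral_cong) (auto simp: dt slab_def indicator_def)
    also have "\<dots> = cone_test x0 R \<beta> \<delta> (T, x) - cone_test x0 R \<beta> \<delta> (0, x)"
    proof (rule integral_FTC_Icc)
      show "((\<lambda>t. cone_test x0 R \<beta> \<delta> (t, x)) has_vector_derivative - (2 / \<beta>) * cone_height x0 R \<beta> \<delta> (t, x)) (at t within {0..T})" for t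
        using cone_test_DERIV_t[of \<beta> x0 R \<delta> x t] assms
        by (auto simp: has_real_derivative_iff_has_vector_derivative intro: has_vector_derivative_at_within)
      show "continuous_on {0..T} (\<lambda>t. - (2 / \<beta>) * cone_height x0 R \<beta> \<delta> (t, x))"
        using assms unfolding cone_height_def by (auto intro!: continuous_intros)
    qed (use T in simp)
    also have "cone_test x0 R \<beta> \<delta> (T, x) = 0" using height_0[of T x] by (simp add: cone_test_def)
    finally show ?thesis by simp
  qed
  have "(LINT z:slab T|lebesgue. d_t (cone_test x0 R \<beta> \<delta>) z) = integral\<^sup>L lborel ?f"
    unfolding set_lebesgue_integral_def by (rule integral_completion) (use f_meas in \<open>simp del: real_scaleR_def\<close>)
  also have "\<dots> = (\<integral>x. (\<integral>t. ?f (t, x) \<partial>lborel) \<partial>lborel)"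
    using lborel_pair.integral_snd[of "\<lambda>t x. ?f (t, x)"] int by (simp add: lborel_prod case_prod_beta')
  also have "\<dots> = - (\<integral>x. cone_test x0 R \<beta> \<delta> (0, x) \<partial>lborel)"
    unfolding inner by simp
  also have "(\<integral>x. cone_test x0 R \<beta> \<delta> (0, x) \<partial>lborel) = (\<integral>x. cone_test x0 R \<beta> \<delta> (0, x) \<partial>lebesgue)"
    by (rule integral_completion[symmetric]) measurable
  finally show ?thesis by simp
qed

section \<open>The relative energy inequality\<close>

definition backward_cone :: "space \<Rightarrow> real \<Rightarrow> real \<Rightarrow> spacetime set" where
  "backward_cone x0 R \<beta> = {z. 0 < fst z \<and> norm (snd z - x0) < R - fst z / \<beta>}"

lemma Linf_AE_bound:
  assumes "f \<in> Linf A"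
  obtains B :: real where "B \<ge> 0" "AE z in lebesgue_on A. norm (f z) \<le> B"
proof -
  have fin: "Linf_norm A f < \<infinity>" using assms by (simp add: Linf_def)
  show thesis
  proof (rule that[of "enn2real (Linf_norm A f)"])
    have "AE z in lebesgue_on A. ennreal (norm (f z)) \<le> Linf_norm A f"
      unfolding Linf_norm_def by (rule esssup_AE)
    then show "AE z in lebesgue_on A. norm (f z) \<le> enn2real (Linf_norm A f)"
    proof (rule AE_mp, intro AE_I2 impI)
      fix z assume "ennreal (norm (f z)) \<le> Linf_norm A f"
      then show "norm (f z) \<le> enn2real (Linf_norm A f)"
        using fin by (cases "Linf_norm A f") auto
    qed
  qed simp
qed

lemma slab_lebesgue [simp]: "slab T \<in> sets lebesgue"
  using slab_borel[of T] by simp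

lemma AE_lebesgue_on: "A \<in> sets lebesgue \<Longrightarrow> (AE z in lebesgue_on A. P z) \<longleftrightarrow> (AE z in lebesgue. z \<in> A \<longrightarrow> P z)"
  by (rule AE_restrict_space_iff) simp

lemma LINT_slab: "(LINT z:slab T|lebesgue. f z) = integral\<^sup>L (lebesgue_on (slab T)) (f :: _ \<Rightarrow> real)"
  unfolding set_lebesgue_integral_def by (subst integral_restrict_space) auto

lemma borel_lebesgue_on: "f \<in> borel_measurable borel \<Longrightarrow> f \<in> borel_measurable (lebesgue_on A)"
  by (intro measurable_restrict_space1 measurable_completion) simp

lemma integrable_times_height:
  assumes "\<beta> > 0" "\<delta> > 0" "R > 0"
    and f: "f \<in> borel_measurable (lebesgue_on (slab T))" "AE z in lebesgue_on (slab T). \<bar>f z\<bar> \<le> B"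
  shows "integrable (lebesgue_on (slab T)) (\<lambda>z. f z * cone_height x0 R \<beta> \<delta> z)"
proof (rule integrableI_bounded_set[where A = "slab T \<inter> ({0..\<beta> * (R - \<delta>)} \<times> cball x0 R)" and B = "B * R"])
  let ?K = "{0..\<beta> * (R - \<delta>)} \<times> cball x0 R"
  have K: "compact ?K" by (intro compact_Times) auto
  have Ks: "?K \<in> sets lebesgue" "slab T \<inter> ?K \<in> sets lebesgue" using compact_imp_closed[OF K] by auto
  then show "slab T \<inter> ?K \<in> sets (lebesgue_on (slab T))"
    by (simp add: sets_restrict_space_iff)
  have "cone_height x0 R \<beta> \<delta> \<in> borel_measurable borel"
    using assms by (intro borel_measurable_continuous_onI continuous_intros) auto
  note [measurable] = borel_lebesgue_on[OF this] f(1)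
  show "(\<lambda>z. f z * cone_height x0 R \<beta> \<delta> z) \<in> borel_measurable (lebesgue_on (slab T))" by measurable
  have "emeasure (lebesgue_on (slab T)) (slab T \<inter> ?K) = emeasure lebesgue (slab T \<inter> ?K)"
    by (rule emeasure_restrict_space) auto
  also have "\<dots> \<le> emeasure lebesgue ?K" using Ks by (intro emeasure_mono) auto
  also have "\<dots> = emeasure lborel ?K" using borel_closed[OF compact_imp_closed[OF K]] by simp
  also have "\<dots> < \<infinity>" using emeasure_bounded_finite[OF compact_imp_bounded[OF K]] .
  finally show "emeasure (lebesgue_on (slab T)) (slab T \<inter> ?K) < \<infinity>" .
  show "AE z in lebesgue_on (slab T). z \<in> slab T \<inter> ?K \<longrightarrow> norm (f z * cone_height x0 R \<beta> \<delta> z) \<le> B * R"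
    using f(2)
  proof (rule AE_mp, intro AE_I2 impI)
    fix z assume "\<bar>f z\<bar> \<le> B" "z \<in> slab T \<inter> ?K"
    then show "norm (f z * cone_height x0 R \<beta> \<delta> z) \<le> B * R"
      using cone_height_le[of \<beta> R z] assms
      by (auto simp: abs_mult slab_def intro!: mult_mono)
  qed
  show "AE z in lebesgue_on (slab T). z \<notin> slab T \<inter> ?K \<longrightarrow> f z * cone_height x0 R \<beta> \<delta> z = 0"
    using cone_height_support[of \<beta> \<delta> _ x0 R] assms
    by (intro AE_I2 impI) (auto simp: slab_def)
qed

lemma integrable_times_cone_test:
  assumes "\<beta> > 0" "\<delta> > 0" "R > 0"
    and f: "f \<in> borel_measurable lebesgue" "AE x in lebesgue. \<bar>f x\<bar> \<le> B"
  shows "integrable lebesgue (\<lambda>x. f x * cone_test x0 R \<beta> \<delta> (0, x))"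
proof (rule integrableI_bounded_set[where A = "cball x0 R" and B = "B * R\<^sup>2"])
  have "continuous_on UNIV (\<lambda>x. cone_height x0 R \<beta> \<delta> (0, x))"
    unfolding cone_height_def using assms by (auto intro!: continuous_intros)
  then have [measurable]: "(\<lambda>x. cone_height x0 R \<beta> \<delta> (0, x)) \<in> borel_measurable lebesgue"
    by (intro measurable_completion) (simp add: borel_measurable_continuous_onI)
  note [measurable] = f(1)
  show "(\<lambda>x. f x * cone_test x0 R \<beta> \<delta> (0, x)) \<in> borel_measurable lebesgue"
    unfolding cone_test_def by measurable
  show "cball x0 R \<in> sets lebesgue" by auto
  show "emeasure lebesgue (cball x0 R) < \<infinity>"
    using emeasure_bounded_finite[OF bounded_cball, of x0 R] by simp
  show "AE x in lebesgue. x \<in> cball x0 R \<longrightarrow> norm (f x * cone_test x0 R \<beta> \<delta> (0, x)) \<le> B * R\<^sup>2"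
    using f(2)
  proof (rule AE_mp, intro AE_I2 impI)
    fix x assume "\<bar>f x\<bar> \<le> B"
    then show "norm (f x * cone_test x0 R \<beta> \<delta> (0, x)) \<le> B * R\<^sup>2"
      using cone_height_le[of \<beta> R "(0, x)"] assms
      by (auto simp: abs_mult cone_test_def intro!: mult_mono power_mono)
  qed
  show "AE x in lebesgue. x \<notin> cball x0 R \<longrightarrow> f x * cone_test x0 R \<beta> \<delta> (0, x) = 0"
    using cone_height_support[of \<beta> \<delta> "(0, _)" x0 R] assms
    by (intro AE_I2 impI) (auto simp: cone_test_def)
qed

text \<open>The entropy inequality, minus \<open>1/(\<gamma> - 1)\<close> times the mass balance, plus \<open>1/\<gamma>\<close> times the balance of the
  constant density. In this combination the densities add up to the relative energy and the
  initial term vanishes, because the data are at rest on the base of the cone. Each derivative of the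
  test function carries the factor \<open>cone_height\<close>, which is factored out.\<close>

lemma relative_energy_inequality:
  assumes \<gamma>: "\<gamma> > 1" and adm: "entropy_admissible \<gamma> T \<rho> u \<rho>0 u0"
    and pos: "\<beta> > 0" "\<delta> > 0" "R > 0" and T: "\<beta> * R \<le> T"
    and init: "AE x in lebesgue. x \<in> ball x0 R \<longrightarrow> \<rho>0 x = 1 \<and> u0 x = 0"
  defines "J \<equiv> \<lambda>z. (- (2 / \<beta>) * rel_energy \<gamma> (\<rho> z) (u z) + rel_flux \<gamma> (\<rho> z) (u z) \<bullet> cone_normal x0 \<delta> z)
                   * cone_height x0 R \<beta> \<delta> z"
  shows "integrable (lebesgue_on (slab T)) J" "integral\<^sup>L (lebesgue_on (slab T)) J \<ge> 0"
proof -
  let ?M = "lebesgue_on (slab T)"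
  let ?H = "cone_height x0 R \<beta> \<delta>"
  let ?G = "cone_normal x0 \<delta>"
  let ?\<phi> = "cone_test x0 R \<beta> \<delta>"
  have weak: "weak_solution \<gamma> T \<rho> u \<rho>0 u0" using adm by (simp add: entropy_admissible_def)
  have ent: "\<And>\<phi>. \<phi> \<in> test_functions T \<Longrightarrow> (\<forall>z\<in>slab T. 0 \<le> \<phi> z) \<Longrightarrow>
        (LINT z:slab T|lebesgue.
           (1/2 * \<rho> z * (norm (u z))\<^sup>2 + 1 / (\<gamma> * (\<gamma> - 1)) * \<rho> z powr \<gamma>) * d_t \<phi> z
           + (1/2 * \<rho> z * (norm (u z))\<^sup>2 + 1 / (\<gamma> - 1) * \<rho> z powr \<gamma>) * (u z \<bullet> grad_x \<phi> z))
        + (LINT x|lebesgue.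
             (1/2 * \<rho>0 x * (norm (u0 x))\<^sup>2 + 1 / (\<gamma> * (\<gamma> - 1)) * \<rho>0 x powr \<gamma>) * \<phi> (0, x)) \<ge> 0"
    using adm by (simp add: entropy_admissible_def)
  have mass: "\<And>\<phi>. \<phi> \<in> test_functions T \<Longrightarrow>
        (LINT z:slab T|lebesgue. \<rho> z * d_t \<phi> z + \<rho> z * (u z \<bullet> grad_x \<phi> z))
        + (LINT x|lebesgue. \<rho>0 x * \<phi> (0, x)) = 0"
    and L: "\<rho> \<in> Linf (slab T)" "u \<in> Linf (slab T)" "\<rho>0 \<in> Linf UNIV" "u0 \<in> Linf UNIV"
    and \<rho>pos: "AE z in ?M. \<rho> z > 0" and \<rho>0pos: "AE x in lebesgue. \<rho>0 x > 0"
    using weak by (simp_all add: weak_solution_def)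
  obtain B where B: "B \<ge> 0" "AE z in ?M. norm (\<rho> z) \<le> B" using Linf_AE_bound[OF L(1)] .
  obtain U where U: "U \<ge> 0" "AE z in ?M. norm (u z) \<le> U" using Linf_AE_bound[OF L(2)] .
  obtain B0 where B0: "B0 \<ge> 0" "AE x in lebesgue. norm (\<rho>0 x) \<le> B0"
    using Linf_AE_bound[OF L(3)] unfolding lebesgue_on_UNIV_eq .
  obtain U0 where U0: "U0 \<ge> 0" "AE x in lebesgue. norm (u0 x) \<le> U0"
    using Linf_AE_bound[OF L(4)] unfolding lebesgue_on_UNIV_eq .
  have m: "\<rho> \<in> borel_measurable ?M" "u \<in> borel_measurable ?M"
    and m0: "\<rho>0 \<in> borel_measurable lebesgue" "u0 \<in> borel_measurable lebesgue"
    using L by (simp_all add: Linf_def lebesgue_on_UNIV_eq)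
  have "?G \<in> borel_measurable borel"
    using pos by (intro borel_measurable_continuous_onI continuous_intros) auto
  note [measurable] = m m0 borel_lebesgue_on[OF this]
  define c0 where "c0 = 1 / (\<gamma> * (\<gamma> - 1))"
  define c1 where "c1 = 1 / (\<gamma> - 1)"
  have c: "c0 > 0" "c1 > 0" using \<gamma> by (auto simp: c0_def c1_def)
  define E where "E = (\<lambda>r (v::space). 1/2 * r * (norm v)\<^sup>2 + c0 * r powr \<gamma>)"
  define Q where "Q = (\<lambda>r (v::space). 1/2 * r * (norm v)\<^sup>2 + c1 * r powr \<gamma>)"
  define FE where "FE = (\<lambda>z. - (2 / \<beta>) * E (\<rho> z) (u z) + Q (\<rho> z) (u z) * (u z \<bullet> ?G z))"
  define FM where "FM = (\<lambda>z. - (2 / \<beta>) * \<rho> z + \<rho> z * (u z \<bullet> ?G z))"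
  have dt: "d_t ?\<phi> z = - (2 / \<beta>) * ?H z" for z using d_t_cone_test[of \<beta>] pos by auto
  have gr: "grad_x ?\<phi> z = ?H z *\<^sub>R ?G z" for z using grad_x_cone_test[of \<delta>] pos by auto
  have tst: "?\<phi> \<in> test_functions T" using cone_test_in_test_functions pos T by blast
  have uG: "\<bar>v \<bullet> ?G z\<bar> \<le> U * 2" if "norm v \<le> U" for v z
    using Cauchy_Schwarz_ineq2[of v "?G z"] mult_mono[OF that norm_cone_normal_le[of x0 \<delta> z]] U by simp
  have kin: "0 \<le> 1/2 * r * (norm v)\<^sup>2 \<and> 1/2 * r * (norm v)\<^sup>2 \<le> b * w\<^sup>2"
    if "norm v \<le> w" "0 < r" "r \<le> b" for r b w and v :: space
  proof -
    have "r * (norm v)\<^sup>2 \<le> b * w\<^sup>2" using that by (intro mult_mono power_mono) auto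
    moreover have "0 \<le> r * (norm v)\<^sup>2" using that by simp
    ultimately show ?thesis by simp
  qed
  have pw: "c * r powr \<gamma> \<le> c * b powr \<gamma>" "0 \<le> c * r powr \<gamma>" if "0 < r" "r \<le> b" "c > 0" for c r b :: real
    using that \<gamma> by (auto intro!: mult_left_mono powr_mono2)
  have E_le: "\<bar>E r v\<bar> \<le> b * w\<^sup>2 + c0 * b powr \<gamma>" if "norm v \<le> w" "0 < r" "r \<le> b" for r b w and v :: space
    using kin[OF that] pw[OF that(2,3) c(1)] unfolding E_def by linarith
  have Q_le: "\<bar>Q r v\<bar> \<le> b * w\<^sup>2 + c1 * b powr \<gamma>" if "norm v \<le> w" "0 < r" "r \<le> b" for r b w and v :: space
    using kin[OF that] pw[OF that(2,3) c(2)] unfolding Q_def by linarith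
  have iE: "integrable ?M (\<lambda>z. FE z * ?H z)"
  proof (rule integrable_times_height[OF pos])
    show "FE \<in> borel_measurable ?M" unfolding FE_def E_def Q_def by measurable
    show "AE z in ?M. \<bar>FE z\<bar> \<le> 2 / \<beta> * (B * U\<^sup>2 + c0 * B powr \<gamma>) + (B * U\<^sup>2 + c1 * B powr \<gamma>) * (U * 2)"
      using \<rho>pos B(2) U(2)
    proof eventually_elim
      case (elim z)
      then have r: "norm (u z) \<le> U" "0 < \<rho> z" "\<rho> z \<le> B" by auto
      have "\<bar>FE z\<bar> \<le> \<bar>- (2 / \<beta>) * E (\<rho> z) (u z)\<bar> + \<bar>Q (\<rho> z) (u z) * (u z \<bullet> ?G z)\<bar>"
        unfolding FE_def by (rule abs_triangle_ineq)
      also have "\<dots> = 2 / \<beta> * \<bar>E (\<rho> z) (u z)\<bar> + \<bar>Q (\<rho> z) (u z)\<bar> * \<bar>u z \<bullet> ?G z\<bar>"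
        using pos by (simp add: abs_mult)
      also have "\<dots> \<le> 2 / \<beta> * (B * U\<^sup>2 + c0 * B powr \<gamma>) + (B * U\<^sup>2 + c1 * B powr \<gamma>) * (U * 2)"
        using E_le[OF r] Q_le[OF r] uG[OF r(1)] pos B(1) c
        by (intro add_mono mult_left_mono mult_mono) auto
      finally show ?case .
    qed
  qed
  have iM: "integrable ?M (\<lambda>z. FM z * ?H z)"
  proof (rule integrable_times_height[OF pos])
    show "FM \<in> borel_measurable ?M" unfolding FM_def by measurable
    show "AE z in ?M. \<bar>FM z\<bar> \<le> 2 / \<beta> * B + B * (U * 2)"
      using B(2) U(2)
    proof eventually_elim
      case (elim z)
      have "\<bar>FM z\<bar> \<le> \<bar>- (2 / \<beta>) * \<rho> z\<bar> + \<bar>\<rho> z * (u z \<bullet> ?G z)\<bar>"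
        unfolding FM_def by (rule abs_triangle_ineq)
      also have "\<dots> = 2 / \<beta> * \<bar>\<rho> z\<bar> + \<bar>\<rho> z\<bar> * \<bar>u z \<bullet> ?G z\<bar>"
        using pos by (simp add: abs_mult)
      also have "\<dots> \<le> 2 / \<beta> * B + B * (U * 2)"
        using elim uG[OF elim(2)] pos B(1) by (intro add_mono mult_left_mono mult_mono) auto
      finally show ?case .
    qed
  qed
  have iC: "integrable ?M (\<lambda>z. - (2 / \<beta>) * ?H z)"
    by (rule integrable_times_height[OF pos, where B = "2 / \<beta>"]) (use pos in auto)
  have jE: "integrable lebesgue (\<lambda>x. E (\<rho>0 x) (u0 x) * ?\<phi> (0, x))"
  proof (rule integrable_times_cone_test[OF pos])
    show "(\<lambda>x. E (\<rho>0 x) (u0 x)) \<in> borel_measurable lebesgue" unfolding E_def by measurable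
    show "AE x in lebesgue. \<bar>E (\<rho>0 x) (u0 x)\<bar> \<le> B0 * U0\<^sup>2 + c0 * B0 powr \<gamma>"
      using \<rho>0pos B0(2) U0(2) by eventually_elim (auto intro!: E_le)
  qed
  have jM: "integrable lebesgue (\<lambda>x. \<rho>0 x * ?\<phi> (0, x))"
    by (rule integrable_times_cone_test[OF pos, where B = B0]) (use B0 in auto)
  have jC: "integrable lebesgue (\<lambda>x. 1 * ?\<phi> (0, x))"
    by (rule integrable_times_cone_test[OF pos, where B = 1]) auto
  have lin: "integral\<^sup>L M (\<lambda>z. f z - a * g z + b * h z) = integral\<^sup>L M f - a * integral\<^sup>L M g + b * integral\<^sup>L M h"
    if "integrable M f" "integrable M g" "integrable M h" for M and f g h :: "'c \<Rightarrow> real" and a b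
    using that by simp
  have rel: "rel_energy \<gamma> r v = E r v - c1 * r + 1 / \<gamma>" for r v
    using \<gamma> by (simp add: rel_energy_def potential_def E_def c0_def c1_def divide_simps) (simp add: algebra_simps)
  have flx: "rel_flux \<gamma> r v = (Q r v - c1 * r) *\<^sub>R v" for r v
    using \<gamma> by (simp add: rel_flux_def Q_def c1_def diff_divide_distrib)
  have J_eq: "J = (\<lambda>z. FE z * ?H z - c1 * (FM z * ?H z) + 1 / \<gamma> * (- (2 / \<beta>) * ?H z))"
    unfolding J_def FE_def FM_def rel flx by (auto simp: algebra_simps)
  show iJ: "integrable ?M J"
    unfolding J_eq using iE integrable_mult_right[OF iM] integrable_mult_right[OF iC]
    by (intro Bochner_Integration.integrable_add Bochner_Integration.integrable_diff)
  have 1: "integral\<^sup>L ?M (\<lambda>z. FE z * ?H z) + (LINT x|lebesgue. E (\<rho>0 x) (u0 x) * ?\<phi> (0, x)) \<ge> 0"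
  proof -
    have "?\<phi> z \<ge> 0" for z by (simp add: cone_test_def)
    then have "(LINT z:slab T|lebesgue. E (\<rho> z) (u z) * d_t ?\<phi> z + Q (\<rho> z) (u z) * (u z \<bullet> grad_x ?\<phi> z))
        + (LINT x|lebesgue. E (\<rho>0 x) (u0 x) * ?\<phi> (0, x)) \<ge> 0"
      using ent[OF tst] by (simp add: E_def Q_def c0_def c1_def)
    moreover have "(\<lambda>z. E (\<rho> z) (u z) * d_t ?\<phi> z + Q (\<rho> z) (u z) * (u z \<bullet> grad_x ?\<phi> z)) = (\<lambda>z. FE z * ?H z)"
      unfolding dt gr FE_def by (auto simp: algebra_simps)
    ultimately show ?thesis by (simp only: LINT_slab)
  qed
  have 2: "integral\<^sup>L ?M (\<lambda>z. FM z * ?H z) + (LINT x|lebesgue. \<rho>0 x * ?\<phi> (0, x)) = 0"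
  proof -
    have "(\<lambda>z. \<rho> z * d_t ?\<phi> z + \<rho> z * (u z \<bullet> grad_x ?\<phi> z)) = (\<lambda>z. FM z * ?H z)"
      unfolding dt gr FM_def by (auto simp: algebra_simps)
    with mass[OF tst] show ?thesis by (simp only: LINT_slab)
  qed
  have 3: "integral\<^sup>L ?M (\<lambda>z. - (2 / \<beta>) * ?H z) + (LINT x|lebesgue. 1 * ?\<phi> (0, x)) = 0"
    using cone_test_const_state[OF pos T, of x0] unfolding dt LINT_slab by simp
  have "(LINT x|lebesgue. E (\<rho>0 x) (u0 x) * ?\<phi> (0, x)) - c1 * (LINT x|lebesgue. \<rho>0 x * ?\<phi> (0, x))
      + 1 / \<gamma> * (LINT x|lebesgue. 1 * ?\<phi> (0, x))
      = (LINT x|lebesgue. E (\<rho>0 x) (u0 x) * ?\<phi> (0, x) - c1 * (\<rho>0 x * ?\<phi> (0, x)) + 1 / \<gamma> * (1 * ?\<phi> (0, x)))"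
    by (rule lin[OF jE jM jC, symmetric])
  also have "\<dots> = (LINT x|lebesgue. rel_energy \<gamma> (\<rho>0 x) (u0 x) * ?\<phi> (0, x))"
    unfolding rel by (intro Bochner_Integration.integral_cong) (auto simp: algebra_simps)
  also have "\<dots> = 0"
  proof (rule integral_eq_zero_AE)
    show "AE x in lebesgue. rel_energy \<gamma> (\<rho>0 x) (u0 x) * ?\<phi> (0, x) = 0"
      using init
    proof eventually_elim
      case (elim x)
      show ?case
      proof (cases "?H (0, x) = 0")
        case False
        then have "?H (0, x) > 0" using cone_height_nonneg[of x0 R \<beta> \<delta> "(0, x)"] by linarith
        from cone_height_posD(1)[OF pos(1) this] pos have "x \<in> ball x0 R"
          by (simp add: dist_norm norm_minus_commute)
        then show ?thesis using elim by (simp add: rel_energy_def)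
      qed (simp add: cone_test_def)
    qed
  qed
  finally have 4: "(LINT x|lebesgue. E (\<rho>0 x) (u0 x) * ?\<phi> (0, x)) - c1 * (LINT x|lebesgue. \<rho>0 x * ?\<phi> (0, x))
      + 1 / \<gamma> * (LINT x|lebesgue. 1 * ?\<phi> (0, x)) = 0" .
  \<comment> \<open>the initial terms fC, fM, fE cancel in the combination that turns the three balances into one\<close>
  have balance: "eE - c1 * eM + g * eC \<ge> 0"
    if "eE + fE \<ge> 0" "eM + fM = 0" "eC + fC = 0" "fE - c1 * fM + g * fC = 0" for eE eM eC fE fM fC g :: real
  proof -
    have "eM = - fM" "eC = - fC" using that by linarith+
    then show ?thesis using that(1,4) by simp
  qed
  have "integral\<^sup>L ?M J = integral\<^sup>L ?M (\<lambda>z. FE z * ?H z) - c1 * integral\<^sup>L ?M (\<lambda>z. FM z * ?H z)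
      + 1 / \<gamma> * integral\<^sup>L ?M (\<lambda>z. - (2 / \<beta>) * ?H z)"
    unfolding J_eq by (rule lin[OF iE iM iC])
  also have "\<dots> \<ge> 0" by (rule balance[OF 1 2 3 4])
  finally show "integral\<^sup>L ?M J \<ge> 0" .
qed

section \<open>Vanishing in a cone\<close>

text \<open>The height of the cone decays in time at rate \<open>1/\<beta>\<close> and has space slope at most \<open>1\<close>, so under the flux bound the
  integrand of the relative energy inequality is at most \<open>-2 (1/\<beta> - \<Lambda>)\<close> times the weighted relative
  energy. Its integral is nonnegative, so it vanishes. Letting \<open>\<delta> = 1/(n + 1)\<close> tend to \<open>0\<close>
  exhausts the cone.\<close>

lemma cone_disturbance_vanishes:
  assumes \<gamma>: "\<gamma> > 1" and adm: "entropy_admissible \<gamma> T \<rho> u \<rho>0 u0"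
    and pos: "\<beta> > 0" "R > 0" and T: "\<beta> * R \<le> T"
    and init: "AE x in lebesgue. x \<in> ball x0 R \<longrightarrow> \<rho>0 x = 1 \<and> u0 x = 0"
    and flux: "AE z in lebesgue. z \<in> backward_cone x0 R \<beta> \<longrightarrow>
      norm (rel_flux \<gamma> (\<rho> z) (u z)) \<le> \<Lambda> * rel_energy \<gamma> (\<rho> z) (u z)"
    and \<Lambda>: "\<beta> * \<Lambda> < 1"
  shows "AE z in lebesgue. z \<in> backward_cone x0 R \<beta> \<longrightarrow> \<rho> z = 1 \<and> u z = 0"
proof -
  let ?H = "\<lambda>n. cone_height x0 R \<beta> (1 / real (Suc n))"
  have cone_slab: "z \<in> slab T" if "z \<in> backward_cone x0 R \<beta>" for z
  proof -
    have "0 < R - fst z / \<beta>"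
      using that norm_ge_zero[of "snd z - x0"] unfolding backward_cone_def mem_Collect_eq by linarith
    then have "fst z < \<beta> * R" using pos by (simp add: field_simps)
    then show ?thesis using that T by (cases z) (auto simp: backward_cone_def slab_def)
  qed
  have \<rho>pos: "AE z in lebesgue. z \<in> slab T \<longrightarrow> \<rho> z > 0"
    using adm by (simp add: entropy_admissible_def weak_solution_def AE_lebesgue_on)
  have tpos: "AE z :: spacetime in lebesgue. fst z \<noteq> (0::real)"
  proof -
    have "negligible {z :: spacetime. (1, 0) \<bullet> z = 0}" by (rule negligible_hyperplane) (simp add: zero_prod_def)
    then have "negligible {z :: spacetime. fst z = 0}" by (simp add: inner_prod_def)
    then show ?thesis unfolding eventually_ae_filter_negligible by (intro exI[of _ "{z. fst z = 0}"]) auto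
  qed
  have "AE z in lebesgue. z \<in> backward_cone x0 R \<beta> \<longrightarrow> ?H n z > 0 \<longrightarrow> \<rho> z = 1 \<and> u z = 0" for n
  proof -
    define \<delta> where "\<delta> = 1 / real (Suc n)"
    have \<delta>: "\<delta> > 0" by (simp add: \<delta>_def)
    define J where "J = (\<lambda>z. (- (2 / \<beta>) * rel_energy \<gamma> (\<rho> z) (u z) + rel_flux \<gamma> (\<rho> z) (u z) \<bullet> cone_normal x0 \<delta> z)
                   * cone_height x0 R \<beta> \<delta> z)"
    note J = relative_energy_inequality[OF \<gamma> adm pos(1) \<delta> pos(2) T init, folded J_def]
    have key: "AE z in lebesgue. z \<in> slab T \<longrightarrow>
        J z \<le> 0 \<and> (J z = 0 \<longrightarrow> z \<in> backward_cone x0 R \<beta> \<longrightarrow> ?H n z > 0 \<longrightarrow> \<rho> z = 1 \<and> u z = 0)"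
      using flux \<rho>pos tpos
    proof (eventually_elim, intro impI)
      case (elim z)
      assume z: "z \<in> slab T"
      let ?e = "rel_energy \<gamma> (\<rho> z) (u z)"
      show "J z \<le> 0 \<and> (J z = 0 \<longrightarrow> z \<in> backward_cone x0 R \<beta> \<longrightarrow> ?H n z > 0 \<longrightarrow> \<rho> z = 1 \<and> u z = 0)"
      proof (cases "?H n z > 0")
        case False
        then have "?H n z = 0" using cone_height_nonneg[of x0 R \<beta> "1 / real (Suc n)" z] by linarith
        then show ?thesis by (simp add: J_def \<delta>_def)
      next
        case True
        have "0 \<le> fst z" using z by (auto simp: slab_def)
        with elim have "z \<in> backward_cone x0 R \<beta>"
          using cone_height_posD(1)[OF pos(1) True] by (auto simp: backward_cone_def)
        with elim have q: "norm (rel_flux \<gamma> (\<rho> z) (u z)) \<le> \<Lambda> * ?e" by auto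
        have r: "\<rho> z > 0" using elim z by auto
        have e: "?e \<ge> 0" using rel_energy_nonneg[OF \<gamma> r] .
        have "rel_flux \<gamma> (\<rho> z) (u z) \<bullet> cone_normal x0 \<delta> z \<le> norm (rel_flux \<gamma> (\<rho> z) (u z)) * norm (cone_normal x0 \<delta> z)"
          by (rule norm_cauchy_schwarz)
        also have "\<dots> \<le> (\<Lambda> * ?e) * 2" using q norm_cone_normal_le[of x0 \<delta> z]
          by (intro mult_mono) (auto intro: order_trans[OF norm_ge_zero])
        finally have "- (2 / \<beta>) * ?e + rel_flux \<gamma> (\<rho> z) (u z) \<bullet> cone_normal x0 \<delta> z \<le> - (2 * (1 / \<beta> - \<Lambda>) * ?e)"
          by (simp add: algebra_simps)
        from mult_right_mono[OF this, of "?H n z"] True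
        have Jle: "J z \<le> - (2 * (1 / \<beta> - \<Lambda>) * ?e * ?H n z)"
          by (simp only: J_def \<delta>_def mult_minus_left)
        have gap: "1 / \<beta> - \<Lambda> > 0" using \<Lambda> pos by (simp add: field_simps)
        then have nn: "2 * (1 / \<beta> - \<Lambda>) * ?e * ?H n z \<ge> 0" using e True by simp
        have "J z = 0 \<longrightarrow> ?e = 0"
        proof
          assume "J z = 0"
          with Jle nn have "2 * (1 / \<beta> - \<Lambda>) * ?e * ?H n z = 0"
            by (intro antisym) simp_all
          then show "?e = 0" using gap True by simp
        qed
        moreover have "J z \<le> 0" using Jle nn by linarith
        ultimately show ?thesis using rel_energy_eq_0_iff[OF \<gamma> r] by blast
      qed
    qed
    have "AE z in lebesgue_on (slab T). 0 \<le> - J z"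
      using key by (auto simp: AE_lebesgue_on elim: eventually_mono)
    moreover have "integral\<^sup>L (lebesgue_on (slab T)) (\<lambda>z. - J z) = 0"
    proof -
      have "integral\<^sup>L (lebesgue_on (slab T)) (\<lambda>z. - J z) \<ge> 0"
        by (rule integral_nonneg_AE) fact
      then show ?thesis using J(2) by simp
    qed
    ultimately have "AE z in lebesgue_on (slab T). - J z = 0"
      using integral_nonneg_eq_0_iff_AE[of "lebesgue_on (slab T)" "\<lambda>z. - J z"] J(1) by simp
    then have "AE z in lebesgue. z \<in> slab T \<longrightarrow> J z = 0" by (simp add: AE_lebesgue_on)
    then show ?thesis using key by eventually_elim (use cone_slab in auto)
  qed
  then have "AE z in lebesgue. \<forall>n. z \<in> backward_cone x0 R \<beta> \<longrightarrow> ?H n z > 0 \<longrightarrow> \<rho> z = 1 \<and> u z = 0"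
    by (intro AE_all_countable[THEN iffD2] allI)
  then show ?thesis
  proof (eventually_elim, intro impI)
    case (elim z)
    assume z: "z \<in> backward_cone x0 R \<beta>"
    then have "R - fst z / \<beta> - norm (snd z - x0) > 0" by (simp add: backward_cone_def)
    then obtain n where n: "1 / real (Suc n) < R - fst z / \<beta> - norm (snd z - x0)"
      using nat_approx_posE by blast
    have "norm (1 / real (Suc n), snd z - x0) \<le> norm (1 / real (Suc n)) + norm (snd z - x0)"
      by (rule norm_Pair_le)
    then have "?H n z > 0" using n by (simp add: cone_height_def)
    then show "\<rho> z = 1 \<and> u z = 0" using elim z by blast
  qed
qed

section \<open>The region of influence and its covering by cones\<close>

lemma Linf_norm_le_iff:
  "f \<in> borel_measurable (lebesgue_on A) \<Longrightarrow>
    Linf_norm A f \<le> c \<longleftrightarrow> (AE z in lebesgue_on A. ennreal (norm (f z)) \<le> c)"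
proof
  assume "Linf_norm A f \<le> c"
  moreover have "AE z in lebesgue_on A. ennreal (norm (f z)) \<le> Linf_norm A f"
    unfolding Linf_norm_def by (rule esssup_AE)
  ultimately show "AE z in lebesgue_on A. ennreal (norm (f z)) \<le> c"
    by (auto elim!: eventually_mono)
qed (auto simp: Linf_norm_def intro!: esssup_I)

lemma Linf_norm_mono:
  assumes "A \<subseteq> B" "A \<in> sets lebesgue" "B \<in> sets lebesgue" "f \<in> borel_measurable (lebesgue_on B)"
  shows "Linf_norm A f \<le> Linf_norm B f"
proof -
  have "f \<in> borel_measurable (lebesgue_on A)" using assms(4,1) by (rule measurable_restrict_mono)
  moreover have "AE z in lebesgue_on B. ennreal (norm (f z)) \<le> Linf_norm B f"
    unfolding Linf_norm_def by (rule esssup_AE)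
  ultimately show ?thesis using assms
    by (auto simp: Linf_norm_le_iff AE_lebesgue_on elim!: eventually_mono)
qed

lemma negligible_graph_time:
  fixes w :: "space \<Rightarrow> real"
  assumes "continuous_on UNIV w"
  shows "negligible {z :: spacetime. fst z = w (snd z)}"
proof -
  let ?G = "{z :: spacetime. fst z = w (snd z)}"
  have "closed ?G" using assms
    by (intro closed_Collect_eq continuous_intros continuous_on_compose2[OF assms]) auto
  then have G: "?G \<in> sets (lborel \<Otimes>\<^sub>M lborel)" unfolding lborel_prod by (simp add: borel_closed)
  have "emeasure (lborel :: spacetime measure) ?G = (\<integral>\<^sup>+x. emeasure lborel ((\<lambda>t. (t, x)) -` ?G) \<partial>lborel)"
    using lborel_pair.emeasure_pair_measure_alt2[OF G] by (simp add: lborel_prod)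
  also have "(\<lambda>x. (\<lambda>t. (t, x)) -` ?G) = (\<lambda>x. {w x})" by auto
  finally have "emeasure (lborel :: spacetime measure) ?G = 0" by simp
  then have "?G \<in> null_sets lborel" using G unfolding lborel_prod null_sets_def by simp
  then show ?thesis by (simp add: negligible_iff_null_sets null_sets_completionI)
qed

text \<open>For \<open>\<alpha> > 0\<close>, the open set where the function defining \<open>cone_region T V \<alpha>\<close> is positive; the
  inequality is multiplied through by \<open>\<alpha>\<close>.\<close>

definition cone_core :: "space set \<Rightarrow> real \<Rightarrow> spacetime set" where
  "cone_core V \<alpha> = {z. fst z < \<alpha> * infdist (snd z) (- V)}"

lemma cone_region_lebesgue [simp]: "cone_region T V \<alpha> \<in> sets lebesgue"
  unfolding cone_region_def by (intro sets.Int slab_lebesgue) auto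

lemma cone_region_subset_slab: "cone_region T V \<alpha> \<subseteq> slab T"
  by (simp add: cone_region_def)

lemma support_cone_dist:
  assumes "\<alpha> > 0"
  shows "support_on (slab T) (cone_dist V \<alpha>) = cone_core V \<alpha> \<inter> slab T"
proof -
  have "cone_dist V \<alpha> z \<noteq> 0 \<longleftrightarrow> z \<in> cone_core V \<alpha>" for z
  proof -
    have "cone_dist V \<alpha> z \<noteq> 0 \<longleftrightarrow> fst z / \<alpha> < infdist (snd z) (- V)"
      unfolding cone_dist_def case_prod_beta by linarith
    then show ?thesis
      using assms by (simp add: cone_core_def pos_divide_less_eq mult.commute)
  qed
  then show ?thesis by (auto simp: support_on_def)
qed

lemma cone_core_subset_region: "\<alpha> > 0 \<Longrightarrow> cone_core V \<alpha> \<inter> slab T \<subseteq> cone_region T V \<alpha>"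
  using closure_subset[of "cone_core V \<alpha> \<inter> slab T"] by (simp add: cone_region_def support_cone_dist)

lemma cone_region_subset:
  assumes "\<alpha> > 0"
  shows "cone_region T V \<alpha> \<subseteq> cone_core V \<alpha> \<union> {z. fst z = \<alpha> * infdist (snd z) (- V)}"
proof -
  have "closed {z :: spacetime. fst z \<le> \<alpha> * infdist (snd z) (- V)}"
    by (intro closed_Collect_le continuous_intros)
  then have "closure (cone_core V \<alpha> \<inter> slab T) \<subseteq> {z. fst z \<le> \<alpha> * infdist (snd z) (- V)}"
    by (intro closure_minimal) (auto simp: cone_core_def)
  then show ?thesis by (auto simp: cone_region_def support_cone_dist[OF assms] cone_core_def)
qed

lemma cone_core_mono: "\<alpha> \<le> \<alpha>' \<Longrightarrow> cone_core V \<alpha> \<subseteq> cone_core V \<alpha>'"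
  unfolding cone_core_def using mult_right_mono[OF _ infdist_nonneg] by (fastforce intro: less_le_trans)

lemma cone_region_mono:
  "0 < \<alpha> \<Longrightarrow> \<alpha> \<le> \<alpha>' \<Longrightarrow> cone_region T V \<alpha> \<subseteq> cone_region T V \<alpha>'"
  unfolding cone_region_def using cone_core_mono[of \<alpha> \<alpha>' V]
  by (auto simp: support_cone_dist intro: closure_mono[THEN subsetD, rotated])

text \<open>Taking the closure only adds points of the graph \<open>t = \<alpha> dist(x, - V)\<close>, which is a null set.\<close>

lemma AE_cone_region_boundary:
  assumes "\<alpha> > 0"
  shows "AE z in lebesgue. z \<in> cone_region T V \<alpha> \<longrightarrow> z \<in> cone_core V \<alpha> \<and> 0 < fst z \<and> fst z < T"
proof -
  have 1: "negligible {z :: spacetime. fst z = \<alpha> * infdist (snd z) (- V)}"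
    by (intro negligible_graph_time continuous_intros)
  have 2: "negligible {z :: spacetime. fst z = 0}"
    by (intro negligible_graph_time[of "\<lambda>x. 0"] continuous_intros)
  show ?thesis
    unfolding eventually_ae_filter_negligible
  proof (intro exI conjI)
    \<comment> \<open>the slice at time 0 is discarded as well, since the open cones do not meet it\<close>
    show "negligible ({z :: spacetime. fst z = \<alpha> * infdist (snd z) (- V)} \<union> {z. fst z = 0})"
      using 1 2 by simp
    show "{z. \<not> (z \<in> cone_region T V \<alpha> \<longrightarrow> z \<in> cone_core V \<alpha> \<and> 0 < fst z \<and> fst z < T)}
        \<subseteq> {z. fst z = \<alpha> * infdist (snd z) (- V)} \<union> {z. fst z = 0}"
      using cone_region_subset[OF assms, of T V] cone_region_subset_slab[of T V \<alpha>]
      by (force simp: slab_def)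
  qed
qed

lemma open_backward_cone: "open (backward_cone x0 R \<beta>)"
  unfolding backward_cone_def divide_inverse by (intro open_Collect_conj open_Collect_less continuous_intros)

lemma cone_time_less:
  assumes "\<beta> > 0" "z \<in> backward_cone x0 R \<beta>"
  shows "0 < fst z" "fst z < \<beta> * R"
proof -
  have "0 < R - fst z / \<beta>"
    using assms(2) norm_ge_zero[of "snd z - x0"] unfolding backward_cone_def mem_Collect_eq by linarith
  then show "fst z < \<beta> * R" using assms(1) by (simp add: field_simps)
qed (use assms in \<open>simp add: backward_cone_def\<close>)

lemma infdist_lipschitz: "infdist x A \<le> infdist y A + norm (y - x)"
  using infdist_triangle[of x A y] by (simp add: dist_norm norm_minus_commute)

lemma ball_subset_infdist: "R \<le> infdist x0 (- V) \<Longrightarrow> ball x0 R \<subseteq> V"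
  using infdist_le[of _ "- V" x0] by fastforce

lemma cone_subset_region:
  assumes "0 < \<beta>" "\<beta> \<le> \<alpha>" "\<beta> * R \<le> T" "R \<le> infdist x0 (- V)"
  shows "backward_cone x0 R \<beta> \<subseteq> cone_region T V \<alpha>"
proof
  fix z assume z: "z \<in> backward_cone x0 R \<beta>"
  have "norm (snd z - x0) < R - fst z / \<beta>" using z by (simp add: backward_cone_def)
  then have "fst z / \<beta> < infdist (snd z) (- V)"
    using infdist_lipschitz[of x0 "- V" "snd z"] assms(4) by linarith
  then have "fst z < \<beta> * infdist (snd z) (- V)" using assms by (simp add: field_simps)
  then have "z \<in> cone_core V \<beta>" by (simp add: cone_core_def)
  moreover have "z \<in> slab T" using cone_time_less[OF assms(1) z] assms(3) by (cases z) (auto simp: slab_def)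
  ultimately show "z \<in> cone_region T V \<alpha>"
    using cone_core_subset_region[OF assms(1)] cone_region_mono[OF assms(1,2)] by blast
qed

text \<open>Every point of the region with \<open>0 < t < T\<close> below the graph lies in a cone over a ball compactly inside
  \<open>V\<close>, with speed strictly below \<open>\<alpha>\<close> and vertex no later than \<open>T\<close>. Negligibility is a
  local property, so the exceptional sets of these uncountably many cones do not accumulate.\<close>

lemma AE_cone_region_if_cones:
  assumes \<alpha>: "\<alpha> > 0"
    and P: "\<And>x0 R \<beta>. 0 < R \<Longrightarrow> 0 < \<beta> \<Longrightarrow> \<beta> < \<alpha> \<Longrightarrow> \<alpha> * R \<le> T \<Longrightarrow> R < infdist x0 (- V) \<Longrightarrow>
          AE z in lebesgue. z \<in> backward_cone x0 R \<beta> \<longrightarrow> P z"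
  shows "AE z in lebesgue. z \<in> cone_region T V \<alpha> \<longrightarrow> P z"
proof -
  define B where "B = {z \<in> cone_core V \<alpha>. 0 < fst z \<and> fst z < T \<and> \<not> P z}"
  have "negligible B"
  proof (subst locally_negligible_alt, intro ballI)
    fix z assume z: "z \<in> B"
    define t where "t = fst z"
    define x where "x = snd z"
    have t: "0 < t" "t < T" "t < \<alpha> * infdist x (- V)"
      using z by (auto simp: B_def cone_core_def t_def x_def)
    then have "t / \<alpha> < min (infdist x (- V)) (T / \<alpha>)" using \<alpha> by (simp add: field_simps)
    then obtain R where R: "t / \<alpha> < R" "R < infdist x (- V)" "R < T / \<alpha>" using dense by (metis min_less_iff_conj)
    have "t / \<alpha> > 0" using t \<alpha> by simp
    then have R0: "R > 0" using R by linarith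
    then have "t / R < \<alpha>" using R \<alpha> by (simp add: field_simps)
    then obtain \<beta> where \<beta>: "t / R < \<beta>" "\<beta> < \<alpha>" using dense by blast
    have "t / R > 0" using t R0 by simp
    then have \<beta>0: "\<beta> > 0" using \<beta> by linarith
    have "\<alpha> * R \<le> T" using R \<alpha> by (simp add: field_simps)
    from P[OF R0 \<beta>0 \<beta>(2) this R(2)]
    obtain N where N: "negligible N" "{z. \<not> (z \<in> backward_cone x R \<beta> \<longrightarrow> P z)} \<subseteq> N"
      unfolding eventually_ae_filter_negligible by blast
    have "z \<in> backward_cone x R \<beta>"
      using t \<beta> \<beta>0 R0 by (auto simp: backward_cone_def t_def x_def field_simps)
    moreover have "negligible (B \<inter> backward_cone x R \<beta>)"
      by (rule negligible_subset[OF N(1)]) (use N(2) in \<open>auto simp: B_def\<close>)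
    moreover have "openin (top_of_set B) (B \<inter> backward_cone x R \<beta>)"
      by (intro openin_open_Int open_backward_cone)
    ultimately show "\<exists>U. openin (top_of_set B) U \<and> z \<in> U \<and> negligible U" using z by blast
  qed
  then have "AE z in lebesgue. z \<notin> B"
    unfolding eventually_ae_filter_negligible by auto
  then show ?thesis using AE_cone_region_boundary[OF \<alpha>, of T V]
    by eventually_elim (auto simp: B_def)
qed

text \<open>The cones that cover the region have speed strictly below \<open>\<alpha>\<close>, so a bound on all slower regions
  passes to the region itself. Together with monotonicity in \<open>\<alpha>\<close> this is left continuity.\<close>

lemma Linf_norm_cone_region_le:
  assumes f: "f \<in> borel_measurable (lebesgue_on (slab T))" and \<alpha>: "\<alpha> > 0"
    and le: "\<And>\<beta>. 0 < \<beta> \<Longrightarrow> \<beta> < \<alpha> \<Longrightarrow> Linf_norm (cone_region T V \<beta>) f \<le> c"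
  shows "Linf_norm (cone_region T V \<alpha>) f \<le> c"
proof -
  have m: "f \<in> borel_measurable (lebesgue_on (cone_region T V \<beta>))" for \<beta>
    using f cone_region_subset_slab by (rule measurable_restrict_mono)
  have "AE z in lebesgue. z \<in> cone_region T V \<alpha> \<longrightarrow> ennreal (norm (f z)) \<le> c"
  proof (rule AE_cone_region_if_cones[OF \<alpha>])
    fix x0 R \<beta> assume R: "0 < R" "0 < \<beta>" "\<beta> < \<alpha>" "\<alpha> * R \<le> T" "R < infdist x0 (- V)"
    have "\<beta> * R \<le> \<alpha> * R" using R by (intro mult_right_mono) auto
    then have "\<beta> * R \<le> T" using R by linarith
    then have "backward_cone x0 R \<beta> \<subseteq> cone_region T V \<beta>"
      using R by (intro cone_subset_region) auto
    moreover have "AE z in lebesgue. z \<in> cone_region T V \<beta> \<longrightarrow> ennreal (norm (f z)) \<le> c"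
      using le[OF R(2,3)] by (simp add: Linf_norm_le_iff m AE_lebesgue_on)
    ultimately show "AE z in lebesgue. z \<in> backward_cone x0 R \<beta> \<longrightarrow> ennreal (norm (f z)) \<le> c"
      by (auto elim!: eventually_mono)
  qed
  then show ?thesis by (simp add: Linf_norm_le_iff m AE_lebesgue_on)
qed

lemma Linf_norm_cone_region_mono:
  assumes f: "f \<in> borel_measurable (lebesgue_on (slab T))" and \<alpha>: "0 < \<alpha>" "\<alpha> \<le> \<alpha>'"
  shows "Linf_norm (cone_region T V \<alpha>) f \<le> Linf_norm (cone_region T V \<alpha>') f"
  using measurable_restrict_mono[OF f cone_region_subset_slab] cone_region_mono[OF \<alpha>]
  by (intro Linf_norm_mono) auto

lemma Linf_norm_cone_region_left_continuous:
  assumes f: "f \<in> borel_measurable (lebesgue_on (slab T))" and \<alpha>: "\<alpha> > 0"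
  shows "((\<lambda>\<alpha>. Linf_norm (cone_region T V \<alpha>) f) \<longlongrightarrow> Linf_norm (cone_region T V \<alpha>) f) (at_left \<alpha>)"
proof (rule order_tendstoI)
  fix c assume c: "c < Linf_norm (cone_region T V \<alpha>) f"
  then obtain \<beta> where \<beta>: "0 < \<beta>" "\<beta> < \<alpha>" "c < Linf_norm (cone_region T V \<beta>) f"
    using Linf_norm_cone_region_le[OF f \<alpha>, of V c] by (meson not_le)
  show "\<forall>\<^sub>F \<alpha>' in at_left \<alpha>. c < Linf_norm (cone_region T V \<alpha>') f"
    unfolding eventually_at_left_field
    using \<beta> Linf_norm_cone_region_mono[OF f \<beta>(1)] by (intro exI[of _ \<beta>]) (auto intro: less_le_trans)
next
  fix c assume c: "Linf_norm (cone_region T V \<alpha>) f < c"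
  show "\<forall>\<^sub>F \<alpha>' in at_left \<alpha>. Linf_norm (cone_region T V \<alpha>') f < c"
    unfolding eventually_at_left_field
  proof (intro exI conjI allI impI)
    fix \<beta> assume "\<beta> > 0" "\<beta> < \<alpha>"
    then have "Linf_norm (cone_region T V \<beta>) f \<le> Linf_norm (cone_region T V \<alpha>) f"
      by (intro Linf_norm_cone_region_mono[OF f]) auto
    then show "Linf_norm (cone_region T V \<beta>) f < c" using c by (rule le_less_trans)
  qed (fact \<alpha>)
qed

section \<open>Vanishing of the disturbance\<close>

lemma disturbance_pos_eq:
  "\<alpha> > 0 \<Longrightarrow> disturbance T \<rho> u \<rho>0 u0 V \<alpha> = Linf_norm (cone_region T V \<alpha>) (\<lambda>z. inverse (\<rho> z) * (\<rho> z - 1))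
           + Linf_norm (cone_region T V \<alpha>) u"
  by (simp add: disturbance_def)

lemma weak_solution_regularity:
  assumes "weak_solution \<gamma> T \<rho> u \<rho>0 u0"
  shows "\<rho> \<in> borel_measurable (lebesgue_on (slab T))" "u \<in> borel_measurable (lebesgue_on (slab T))"
    "(\<lambda>z. inverse (\<rho> z) * (\<rho> z - 1)) \<in> borel_measurable (lebesgue_on (slab T))"
    "AE z in lebesgue. z \<in> slab T \<longrightarrow> \<rho> z > 0"
proof -
  show m: "\<rho> \<in> borel_measurable (lebesgue_on (slab T))" "u \<in> borel_measurable (lebesgue_on (slab T))"
    using assms by (auto simp: weak_solution_def Linf_def)
  show "(\<lambda>z. inverse (\<rho> z) * (\<rho> z - 1)) \<in> borel_measurable (lebesgue_on (slab T))"
    using m(1) by measurable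
  show "AE z in lebesgue. z \<in> slab T \<longrightarrow> \<rho> z > 0"
    using assms by (simp add: weak_solution_def AE_lebesgue_on)
qed

lemma AE_le_of_Linf_norm_add_le:
  fixes f :: "spacetime \<Rightarrow> 'b::real_normed_vector" and g :: "spacetime \<Rightarrow> 'c::real_normed_vector"
  assumes A: "A \<in> sets lebesgue" and le: "Linf_norm A f + Linf_norm A g \<le> ennreal \<epsilon>" and \<epsilon>: "\<epsilon> \<ge> 0"
  shows "AE z in lebesgue. z \<in> A \<longrightarrow> norm (f z) + norm (g z) \<le> \<epsilon>"
proof -
  have "AE z in lebesgue_on A. ennreal (norm (f z)) \<le> Linf_norm A f"
    and "AE z in lebesgue_on A. ennreal (norm (g z)) \<le> Linf_norm A g"
    unfolding Linf_norm_def by (rule esssup_AE)+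
  then have "AE z in lebesgue_on A. norm (f z) + norm (g z) \<le> \<epsilon>"
  proof eventually_elim
    case (elim z)
    have "ennreal (norm (f z) + norm (g z)) = ennreal (norm (f z)) + ennreal (norm (g z))"
      by (rule ennreal_plus) auto
    also have "\<dots> \<le> Linf_norm A f + Linf_norm A g" using elim by (rule add_mono)
    also note le
    finally show ?case using \<epsilon> by (simp only: ennreal_le_iff)
  qed
  then show ?thesis by (simp add: AE_lebesgue_on[OF A])
qed

lemma initial_rest_state:
  assumes "weak_solution \<gamma> T \<rho> u \<rho>0 u0" "closed V" "disturbance T \<rho> u \<rho>0 u0 V 0 = 0"
  shows "AE x in lebesgue. x \<in> V \<longrightarrow> \<rho>0 x = 1 \<and> u0 x = 0"
proof -
  have V: "V \<in> sets lebesgue" using assms(2) by (simp add: borel_closed)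
  have N: "Linf_norm V (\<lambda>x. inverse (\<rho>0 x) * (\<rho>0 x - 1)) = 0" "Linf_norm V u0 = 0"
    using assms(3) by (auto simp: disturbance_def)
  have "AE x in lebesgue_on V. ennreal (norm (inverse (\<rho>0 x) * (\<rho>0 x - 1))) \<le> 0"
    using esssup_AE[of "\<lambda>x. ennreal (norm (inverse (\<rho>0 x) * (\<rho>0 x - 1)))" "lebesgue_on V"]
    by (simp only: N(1)[unfolded Linf_norm_def])
  moreover have "AE x in lebesgue_on V. ennreal (norm (u0 x)) \<le> 0"
    using esssup_AE[of "\<lambda>x. ennreal (norm (u0 x))" "lebesgue_on V"]
    by (simp only: N(2)[unfolded Linf_norm_def])
  moreover have "AE x in lebesgue. \<rho>0 x > 0" using assms(1) by (simp add: weak_solution_def)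
  ultimately show ?thesis
    unfolding AE_lebesgue_on[OF V] by eventually_elim auto
qed

lemma disturbance_eq_0:
  assumes w: "weak_solution \<gamma> T \<rho> u \<rho>0 u0" and \<alpha>: "\<alpha> > 0"
    and vanish: "AE z in lebesgue. z \<in> cone_region T V \<alpha> \<longrightarrow> \<rho> z = 1 \<and> u z = 0"
  shows "disturbance T \<rho> u \<rho>0 u0 V \<alpha> = 0"
proof -
  note m = weak_solution_regularity[OF w]
  have "Linf_norm (cone_region T V \<alpha>) (\<lambda>z. inverse (\<rho> z) * (\<rho> z - 1)) \<le> 0"
    using vanish by (subst Linf_norm_le_iff[OF measurable_restrict_mono[OF m(3) cone_region_subset_slab]])
      (auto simp: AE_lebesgue_on elim!: eventually_mono)
  moreover have "Linf_norm (cone_region T V \<alpha>) u \<le> 0"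
    using vanish by (subst Linf_norm_le_iff[OF measurable_restrict_mono[OF m(2) cone_region_subset_slab]])
      (auto simp: AE_lebesgue_on elim!: eventually_mono)
  ultimately show ?thesis by (simp add: disturbance_pos_eq[OF \<alpha>])
qed

lemma cone_vanishes_if_small:
  assumes \<gamma>: "\<gamma> > 1" and adm: "entropy_admissible \<gamma> T \<rho> u \<rho>0 u0"
    and C: "C > 0" "\<And>r v. r > 0 \<Longrightarrow> norm (rel_flux \<gamma> r v) \<le> (1 + C * (\<bar>inverse r * (r - 1)\<bar> + norm v)) * rel_energy \<gamma> r v"
    and pos: "\<beta> > 0" "R > 0" and T: "\<beta> * R \<le> T"
    and init: "AE x in lebesgue. x \<in> V \<longrightarrow> \<rho>0 x = 1 \<and> u0 x = 0" and R: "R \<le> infdist x0 (- V)"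
    and small: "AE z in lebesgue. z \<in> backward_cone x0 R \<beta> \<longrightarrow> \<bar>inverse (\<rho> z) * (\<rho> z - 1)\<bar> + norm (u z) \<le> \<epsilon>"
    and \<epsilon>: "\<beta> * (1 + C * \<epsilon>) < 1"
  shows "AE z in lebesgue. z \<in> backward_cone x0 R \<beta> \<longrightarrow> \<rho> z = 1 \<and> u z = 0"
proof (rule cone_disturbance_vanishes[OF \<gamma> adm pos T _ _ \<epsilon>])
  show "AE x in lebesgue. x \<in> ball x0 R \<longrightarrow> \<rho>0 x = 1 \<and> u0 x = 0"
    using init ball_subset_infdist[OF R] by (auto elim!: eventually_mono)
  have "AE z in lebesgue. z \<in> slab T \<longrightarrow> \<rho> z > 0"
    using adm weak_solution_regularity(4) by (auto simp: entropy_admissible_def)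
  with small show "AE z in lebesgue. z \<in> backward_cone x0 R \<beta> \<longrightarrow>
      norm (rel_flux \<gamma> (\<rho> z) (u z)) \<le> (1 + C * \<epsilon>) * rel_energy \<gamma> (\<rho> z) (u z)"
  proof (eventually_elim, intro impI)
    case (elim z)
    assume z: "z \<in> backward_cone x0 R \<beta>"
    then have "z \<in> slab T" using cone_time_less[OF pos(1) z] T by (cases z) (auto simp: slab_def)
    with elim have r: "\<rho> z > 0" by blast
    have "norm (rel_flux \<gamma> (\<rho> z) (u z)) \<le> (1 + C * (\<bar>inverse (\<rho> z) * (\<rho> z - 1)\<bar> + norm (u z))) * rel_energy \<gamma> (\<rho> z) (u z)"
      using C(2)[OF r] .
    also have "\<dots> \<le> (1 + C * \<epsilon>) * rel_energy \<gamma> (\<rho> z) (u z)"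
      using elim z C(1) rel_energy_nonneg[OF \<gamma> r] by (intro mult_right_mono add_left_mono mult_left_mono) auto
    finally show "norm (rel_flux \<gamma> (\<rho> z) (u z)) \<le> (1 + C * \<epsilon>) * rel_energy \<gamma> (\<rho> z) (u z)" .
  qed
qed

text \<open>The bootstrap: a bound \<open>\<epsilon>\<close> on the disturbance in the region of speed \<open>\<alpha>\<close> improves to \<open>0\<close> as soon as the
  maximal signal speed \<open>1 + C \<epsilon>\<close> is below \<open>1/\<alpha>\<close>.\<close>

lemma region_vanishes_if_small:
  assumes \<gamma>: "\<gamma> > 1" and adm: "entropy_admissible \<gamma> T \<rho> u \<rho>0 u0"
    and C: "C > 0" "\<And>r v. r > 0 \<Longrightarrow> norm (rel_flux \<gamma> r v) \<le> (1 + C * (\<bar>inverse r * (r - 1)\<bar> + norm v)) * rel_energy \<gamma> r v"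
    and V: "closed V" and F0: "disturbance T \<rho> u \<rho>0 u0 V 0 = 0"
    and \<alpha>: "\<alpha> > 0" "disturbance T \<rho> u \<rho>0 u0 V \<alpha> \<le> ennreal \<epsilon>" "\<epsilon> \<ge> 0" "\<alpha> * (1 + C * \<epsilon>) < 1"
  shows "AE z in lebesgue. z \<in> cone_region T V \<alpha> \<longrightarrow> \<rho> z = 1 \<and> u z = 0"
proof (rule AE_cone_region_if_cones[OF \<alpha>(1)])
  have w: "weak_solution \<gamma> T \<rho> u \<rho>0 u0" using adm by (simp add: entropy_admissible_def)
  fix x0 R \<beta> assume R: "0 < R" "0 < \<beta>" "\<beta> < \<alpha>" "\<alpha> * R \<le> T" "R < infdist x0 (- V)"
  have "\<beta> * R \<le> \<alpha> * R" using R by (intro mult_right_mono) auto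
  then have T: "\<beta> * R \<le> T" using R by linarith
  have small: "AE z in lebesgue. z \<in> cone_region T V \<alpha> \<longrightarrow> \<bar>inverse (\<rho> z) * (\<rho> z - 1)\<bar> + norm (u z) \<le> \<epsilon>"
    using AE_le_of_Linf_norm_add_le[OF cone_region_lebesgue \<alpha>(2)[unfolded disturbance_pos_eq[OF \<alpha>(1)]] \<alpha>(3)]
    by simp
  show "AE z in lebesgue. z \<in> backward_cone x0 R \<beta> \<longrightarrow> \<rho> z = 1 \<and> u z = 0"
  proof (rule cone_vanishes_if_small[OF \<gamma> adm C R(2,1) T initial_rest_state[OF w V F0]])
    show "AE z in lebesgue. z \<in> backward_cone x0 R \<beta> \<longrightarrow> \<bar>inverse (\<rho> z) * (\<rho> z - 1)\<bar> + norm (u z) \<le> \<epsilon>"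
      using small cone_subset_region[OF R(2) less_imp_le[OF R(3)] T less_imp_le[OF R(5)]]
      by (auto elim!: eventually_mono)
    have "\<beta> * (1 + C * \<epsilon>) \<le> \<alpha> * (1 + C * \<epsilon>)" using R C \<alpha>(3) by (intro mult_right_mono) auto
    then show "\<beta> * (1 + C * \<epsilon>) < 1" using \<alpha>(4) by linarith
  qed (use R in auto)
qed

lemma continuous_eq_on_open_if_AE:
  fixes g :: "'a::euclidean_space \<Rightarrow> 'b::metric_space"
  assumes "open U" "continuous_on U g" "AE z in lebesgue. z \<in> U \<longrightarrow> g z = c" "z \<in> U"
  shows "g z = c"
proof -
  have "open (U \<inter> g -` (- {c}))"
    using assms(1,2) by (intro continuous_open_preimage) auto
  moreover have "negligible (U \<inter> g -` (- {c}))"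
  proof -
    obtain N where "negligible N" "{z. \<not> (z \<in> U \<longrightarrow> g z = c)} \<subseteq> N"
      using assms(3) unfolding eventually_ae_filter_negligible by blast
    then show ?thesis by (elim negligible_subset) auto
  qed
  ultimately have "U \<inter> g -` (- {c}) = {}" using open_not_negligible by blast
  then show ?thesis using assms(4) by auto
qed

text \<open>Let \<open>P b\<close> say that the disturbance vanishes in the cone of speed \<open>b \<le> \<beta>\<close>. It holds for small \<open>b\<close> by the
  global bound \<open>m\<close>. If \<open>P b\<close> holds, every point of a slightly wider cone is moved into the
  cone of speed \<open>b\<close> by rescaling time, and uniform continuity of \<open>g\<close> makes the disturbance there
  so small that it must vanish. The widening factor \<open>\<kappa> > 1\<close> depends only on the modulus of continuity, so
  iteration reaches \<open>\<beta>\<close>.\<close>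

lemma continuous_cone_vanishes:
  assumes \<gamma>: "\<gamma> > 1" and adm: "entropy_admissible \<gamma> T \<rho> u \<rho>0 u0"
    and C: "C > 0" "\<And>r v. r > 0 \<Longrightarrow> norm (rel_flux \<gamma> r v) \<le> (1 + C * (\<bar>inverse r * (r - 1)\<bar> + norm v)) * rel_energy \<gamma> r v"
    and m: "m > 0" "AE z in lebesgue. z \<in> slab T \<longrightarrow> \<bar>inverse (\<rho> z) * (\<rho> z - 1)\<bar> + norm (u z) \<le> m"
    and pos: "0 < \<beta>" "\<beta> < 1" "R > 0" and T: "\<beta> * R < T"
    and init: "AE x in lebesgue. x \<in> V \<longrightarrow> \<rho>0 x = 1 \<and> u0 x = 0" and R: "R \<le> infdist x0 (- V)"
    and g: "continuous_on {z. 0 \<le> fst z \<and> norm (snd z - x0) \<le> R - fst z / \<beta>} g"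
      "AE z in lebesgue. z \<in> backward_cone x0 R \<beta> \<longrightarrow> (\<rho> z, u z) = g z"
  shows "AE z in lebesgue. z \<in> backward_cone x0 R \<beta> \<longrightarrow> \<rho> z = 1 \<and> u z = 0"
proof -
  define K where "K = {z :: spacetime. 0 \<le> fst z \<and> norm (snd z - x0) \<le> R - fst z / \<beta>}"
  define P where "P b \<longleftrightarrow> (AE z in lebesgue. z \<in> backward_cone x0 R b \<longrightarrow> \<rho> z = 1 \<and> u z = 0)" for b
  have Tpos: "T > 0" using T pos by (smt (verit) mult_pos_pos)
  have compact: "compact K"
  proof -
    have "closed K"
      unfolding K_def divide_inverse by (intro closed_Collect_conj closed_Collect_le continuous_intros)
    moreover have "K \<subseteq> {0..\<beta> * R} \<times> cball x0 R"
    proof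
      fix z assume z: "z \<in> K"
      then have "0 \<le> fst z / \<beta>" using pos by (simp add: K_def)
      moreover have "norm (snd z - x0) \<le> R - fst z / \<beta>" using z by (simp add: K_def)
      moreover note norm_ge_zero[of "snd z - x0"]
      ultimately have "norm (snd z - x0) \<le> R" "fst z / \<beta> \<le> R" by linarith+
      then show "z \<in> {0..\<beta> * R} \<times> cball x0 R"
        using z pos by (cases z) (auto simp: K_def dist_norm norm_minus_commute field_simps)
    qed
    moreover have "compact ({0..\<beta> * R} \<times> cball x0 R)" by (intro compact_Times) auto
    ultimately show ?thesis by (metis compact_Int_closed inf.absorb2 inf_commute)
  qed
  have sub: "backward_cone x0 R b \<subseteq> backward_cone x0 R b'" if "0 < b" "b \<le> b'" for b b'
  proof
    fix z assume z: "z \<in> backward_cone x0 R b"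
    then have "fst z / b' \<le> fst z / b" using that by (intro divide_left_mono) (auto simp: backward_cone_def)
    then show "z \<in> backward_cone x0 R b'" using z by (auto simp: backward_cone_def)
  qed
  have subK: "backward_cone x0 R b \<subseteq> K" if "0 < b" "b \<le> \<beta>" for b
    using sub[OF that] by (auto simp: K_def backward_cone_def)
  have gK: "continuous_on K g" using g(1) by (simp add: K_def)
  have bT: "b * R \<le> T" if "b \<le> \<beta>" for b
    using mult_right_mono[OF that, of R] pos T by linarith
  \<comment> \<open>half of the largest size that the speed \<open>\<beta>\<close> tolerates\<close>
  define \<epsilon> where "\<epsilon> = (1 / \<beta> - 1) / (2 * C)"
  have "1 / \<beta> > 1" using pos by simp
  then have \<epsilon>: "\<epsilon> > 0" using C by (simp add: \<epsilon>_def)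
  have "\<beta> * (1 + C * \<epsilon>) = (\<beta> + 1) / 2" using C pos by (simp add: \<epsilon>_def field_simps)
  then have \<epsilon>1: "\<beta> * (1 + C * \<epsilon>) < 1" using pos by simp
  \<comment> \<open>\<open>|\<rho> - 1| < \<eta> \<le> 1/2\<close> gives \<open>|\<rho>\<^sup>-\<^sup>1(\<rho> - 1)| \<le> 2 \<eta>\<close>, and \<open>|u| < \<eta>\<close> takes the third \<open>\<eta>\<close>\<close>
  define \<eta> where "\<eta> = min (1/2) (\<epsilon> / 3)"
  have \<eta>: "\<eta> > 0" "\<eta> \<le> 1/2" "3 * \<eta> \<le> \<epsilon>" using \<epsilon> by (auto simp: \<eta>_def)
  obtain d where d: "d > 0" "\<And>z z'. z \<in> K \<Longrightarrow> z' \<in> K \<Longrightarrow> dist z' z < d \<Longrightarrow> dist (g z') (g z) < \<eta>"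
    using compact_uniformly_continuous[OF gK compact] \<eta>(1) unfolding uniformly_continuous_on_def by metis
  define \<kappa> where "\<kappa> = 1 + d / T"
  have \<kappa>: "\<kappa> > 1" using d Tpos by (simp add: \<kappa>_def)
  have step: "P b'" if b: "0 < b" "b \<le> b'" "b' \<le> \<beta>" "b' \<le> \<kappa> * b" and Pb: "P b" for b b'
  proof -
    have b': "0 < b'" using b by linarith
    have rest: "g z = (1, 0)" if z: "z \<in> backward_cone x0 R b" for z
    proof (rule continuous_eq_on_open_if_AE[OF open_backward_cone _ _ z])
      show "continuous_on (backward_cone x0 R b) g"
        using gK subK[of b] b by (meson continuous_on_subset order_trans)
      show "AE z in lebesgue. z \<in> backward_cone x0 R b \<longrightarrow> g z = (1, 0)"
        using g(2) Pb[unfolded P_def]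
      proof eventually_elim
        case (elim z)
        then show ?case using sub[of b \<beta>] b by auto
      qed
    qed
    have near: "dist (1, 0) (g z) < \<eta>" if z: "z \<in> backward_cone x0 R b'" for z
    proof -
      \<comment> \<open>time is contracted by \<open>b / b'\<close>; the displacement is less than \<open>T (1 - b / b') \<le> d\<close>\<close>
      define z' where "z' = (fst z * (b / b'), snd z)"
      have z': "z' \<in> backward_cone x0 R b" using z b b' by (auto simp: z'_def backward_cone_def)
      have t: "0 < fst z" "fst z < T" using cone_time_less[OF b' z] bT[OF b(3)] by auto
      have "b' - b \<le> d / T * b" using b(4) by (simp add: \<kappa>_def algebra_simps)
      also have "\<dots> \<le> d / T * b'" using b d Tpos by (intro mult_left_mono) auto
      finally have bb: "1 - b / b' \<le> d / T" using b' by (simp add: field_simps)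
      have "b / b' \<le> 1" using b by simp
      then have "fst z * (1 - b / b') \<ge> 0" using t by simp
      moreover have "dist z' z = \<bar>- (fst z * (1 - b / b'))\<bar>"
        unfolding z'_def dist_prod_def dist_real_def by (simp add: right_diff_distrib)
      ultimately have "dist z' z = fst z * (1 - b / b')" by (simp only: abs_minus_cancel abs_of_nonneg)
      also have "\<dots> \<le> fst z * (d / T)" using bb t by (intro mult_left_mono) auto
      also have "\<dots> < T * (d / T)" using t d Tpos by (intro mult_strict_right_mono) auto
      finally have "dist z' z < d" using Tpos by simp
      then have "dist (g z') (g z) < \<eta>"
        using z z' subK[OF b'] subK[OF b(1)] b by (intro d(2)) auto
      then show ?thesis by (simp add: rest[OF z'])
    qed
    show "P b'"
      unfolding P_def
    proof (rule cone_vanishes_if_small[OF \<gamma> adm C b' pos(3) bT[OF b(3)] init R])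
      have "b' * (1 + C * \<epsilon>) \<le> \<beta> * (1 + C * \<epsilon>)" using b C \<epsilon> by (intro mult_right_mono) auto
      then show "b' * (1 + C * \<epsilon>) < 1" using \<epsilon>1 by linarith
      show "AE z in lebesgue. z \<in> backward_cone x0 R b' \<longrightarrow> \<bar>inverse (\<rho> z) * (\<rho> z - 1)\<bar> + norm (u z) \<le> \<epsilon>"
        using g(2)
      proof (eventually_elim, intro impI)
        case (elim z)
        assume z: "z \<in> backward_cone x0 R b'"
        then have "g z = (\<rho> z, u z)" using elim sub[OF b' b(3)] by auto
        with near[OF z] have n: "dist (1, 0) (\<rho> z, u z) < \<eta>" by simp
        have r: "\<bar>\<rho> z - 1\<bar> < \<eta>" and v: "norm (u z) < \<eta>"
          using dist_fst_le[of "(1, 0)" "(\<rho> z, u z)"] dist_snd_le[of "(1, 0)" "(\<rho> z, u z)"] n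
          by (auto simp: dist_real_def)
        have r2: "\<rho> z \<ge> 1/2" using r \<eta> by linarith
        then have "inverse (\<rho> z) \<le> 2" using le_imp_inverse_le[OF r2] by simp
        then have "\<bar>inverse (\<rho> z) * (\<rho> z - 1)\<bar> \<le> 2 * \<eta>"
          using r r2 unfolding abs_mult by (intro mult_mono) auto
        then show "\<bar>inverse (\<rho> z) * (\<rho> z - 1)\<bar> + norm (u z) \<le> \<epsilon>" using v \<eta> by linarith
      qed
    qed
  qed
  define b0 where "b0 = min \<beta> (1 / (2 * (1 + C * m)))"
  have Cm: "1 + C * m > 1" using C m by simp
  have b0: "0 < b0" "b0 \<le> \<beta>" using pos Cm by (auto simp: b0_def)
  have P0: "P b0"
    unfolding P_def
  proof (rule cone_vanishes_if_small[OF \<gamma> adm C b0(1) pos(3) bT[OF b0(2)] init R])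
    have half: "1 / (2 * k) * k = 1 / 2" if "k > 1" for k :: real using that by simp
    have "b0 * (1 + C * m) \<le> 1 / (2 * (1 + C * m)) * (1 + C * m)"
      using Cm by (intro mult_right_mono) (auto simp: b0_def)
    then have "b0 * (1 + C * m) \<le> 1 / 2" unfolding half[OF Cm] .
    then show "b0 * (1 + C * m) < 1" by simp
    show "AE z in lebesgue. z \<in> backward_cone x0 R b0 \<longrightarrow> \<bar>inverse (\<rho> z) * (\<rho> z - 1)\<bar> + norm (u z) \<le> m"
      using m(2)
    proof (eventually_elim, intro impI)
      case (elim z)
      assume z: "z \<in> backward_cone x0 R b0"
      then have "z \<in> slab T" using cone_time_less[OF b0(1) z] bT[OF b0(2)] by (cases z) (auto simp: slab_def)
      then show "\<bar>inverse (\<rho> z) * (\<rho> z - 1)\<bar> + norm (u z) \<le> m" using elim by blast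
    qed
  qed
  have iter: "P (min \<beta> (\<kappa> ^ n * b0))" for n
  proof (induction n)
    case 0
    then show ?case using P0 b0 by (simp add: min_absorb2)
  next
    case (Suc n)
    let ?b = "\<kappa> ^ n * b0"
    have b: "?b > 0" using \<kappa> b0 by simp
    have mono: "?b \<le> \<kappa> * ?b" using mult_right_mono[OF less_imp_le[OF \<kappa>] less_imp_le[OF b]] by (simp only: mult_1_left)
    have "\<beta> \<le> \<kappa> * \<beta>" using \<kappa> pos by simp
    then have "min \<beta> (\<kappa> * ?b) \<le> \<kappa> * min \<beta> ?b" unfolding min_def by auto
    moreover have "0 < min \<beta> ?b" using b pos by simp
    moreover have "min \<beta> ?b \<le> min \<beta> (\<kappa> * ?b)" using mono by (intro min.mono) auto
    moreover have "min \<beta> (\<kappa> * ?b) \<le> \<beta>" by simp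
    ultimately have "P (min \<beta> (\<kappa> * ?b))" using step Suc by blast
    then show ?case by (simp only: power_Suc mult.assoc)
  qed
  obtain n where "\<beta> / b0 < \<kappa> ^ n" using real_arch_pow[OF \<kappa>] by blast
  then have "\<beta> \<le> \<kappa> ^ n * b0" using b0 by (simp add: field_simps)
  then have "min \<beta> (\<kappa> ^ n * b0) = \<beta>" by simp
  with iter[of n] show ?thesis by (simp add: P_def)
qed

lemma continuous_region_vanishes:
  assumes \<gamma>: "\<gamma> > 1" and adm: "entropy_admissible \<gamma> T \<rho> u \<rho>0 u0"
    and C: "C > 0" "\<And>r v. r > 0 \<Longrightarrow> norm (rel_flux \<gamma> r v) \<le> (1 + C * (\<bar>inverse r * (r - 1)\<bar> + norm v)) * rel_energy \<gamma> r v"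
    and m: "m > 0" "AE z in lebesgue. z \<in> slab T \<longrightarrow> \<bar>inverse (\<rho> z) * (\<rho> z - 1)\<bar> + norm (u z) \<le> m"
    and init: "AE x in lebesgue. x \<in> V \<longrightarrow> \<rho>0 x = 1 \<and> u0 x = 0"
    and \<alpha>: "0 < \<alpha>" "\<alpha> \<le> 1" and cont: "has_continuous_representative (cone_region T V \<alpha>) (\<lambda>z. (\<rho> z, u z))"
  shows "AE z in lebesgue. z \<in> cone_region T V \<alpha> \<longrightarrow> \<rho> z = 1 \<and> u z = 0"
proof (rule AE_cone_region_if_cones[OF \<alpha>(1)])
  fix x0 R \<beta> assume R: "0 < R" "0 < \<beta>" "\<beta> < \<alpha>" "\<alpha> * R \<le> T" "R < infdist x0 (- V)"
  have "\<beta> * R < \<alpha> * R" using R by (intro mult_strict_right_mono) auto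
  then have T: "\<beta> * R < T" using R by linarith
  obtain g where g: "continuous_on (cone_region T V \<alpha>) g" "AE z in lebesgue. z \<in> cone_region T V \<alpha> \<longrightarrow> (\<rho> z, u z) = g z"
    using cont unfolding has_continuous_representative_def by (auto simp: AE_lebesgue_on)
  show "AE z in lebesgue. z \<in> backward_cone x0 R \<beta> \<longrightarrow> \<rho> z = 1 \<and> u z = 0"
  proof (rule continuous_cone_vanishes[OF \<gamma> adm C m R(2) _ R(1) T init])
    show "\<beta> < 1" "R \<le> infdist x0 (- V)" using R \<alpha> by auto
    show "AE z in lebesgue. z \<in> backward_cone x0 R \<beta> \<longrightarrow> (\<rho> z, u z) = g z"
      using g(2) cone_subset_region[of \<beta> \<alpha> R T x0 V] R T by (auto elim!: eventually_mono)
    have "{z. 0 \<le> fst z \<and> norm (snd z - x0) \<le> R - fst z / \<beta>} \<subseteq> cone_core V \<beta> \<inter> slab T"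
    proof
      fix z assume z: "z \<in> {z. 0 \<le> fst z \<and> norm (snd z - x0) \<le> R - fst z / \<beta>}"
      then have n: "norm (snd z - x0) \<le> R - fst z / \<beta>" "0 \<le> fst z" by auto
      then have "fst z / \<beta> < infdist (snd z) (- V)"
        using infdist_lipschitz[of x0 "- V" "snd z"] R(5) by linarith
      then have "z \<in> cone_core V \<beta>" using R by (simp add: cone_core_def field_simps)
      moreover have "fst z / \<beta> \<le> R" using n norm_ge_zero[of "snd z - x0"] by linarith
      then have "fst z < T" using R T by (simp add: field_simps)
      ultimately show "z \<in> cone_core V \<beta> \<inter> slab T" using n by (cases z) (auto simp: slab_def)
    qed
    also have "\<dots> \<subseteq> cone_region T V \<alpha>"
      using cone_core_subset_region[OF R(2), of V T] cone_region_mono[OF R(2), of \<alpha> T V] R(3) by simp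
    finally show "continuous_on {z. 0 \<le> fst z \<and> norm (snd z - x0) \<le> R - fst z / \<beta>} g"
      using g(1) by (rule continuous_on_subset[rotated])
  qed
qed

lemma mono_tendsto_INF_at_right:
  fixes F :: "real \<Rightarrow> ennreal"
  assumes "a < b" "mono_on {a<..b} F"
  shows "(F \<longlongrightarrow> (INF \<alpha>\<in>{a<..b}. F \<alpha>)) (at_right a)"
proof (rule order_tendstoI)
  fix c assume c: "c < (INF \<alpha>\<in>{a<..b}. F \<alpha>)"
  show "\<forall>\<^sub>F \<alpha> in at_right a. c < F \<alpha>"
    unfolding eventually_at_right_field
    using assms(1) by (intro exI[of _ b]) (auto intro!: less_le_trans[OF c INF_lower])
next
  fix c assume "(INF \<alpha>\<in>{a<..b}. F \<alpha>) < c"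
  then obtain \<beta> where \<beta>: "\<beta> \<in> {a<..b}" "F \<beta> < c" unfolding INF_less_iff by blast
  show "\<forall>\<^sub>F \<alpha> in at_right a. F \<alpha> < c"
    unfolding eventually_at_right_field
  proof (intro exI[of _ \<beta>] conjI allI impI)
    fix \<alpha> assume "a < \<alpha>" "\<alpha> < \<beta>"
    then have "F \<alpha> \<le> F \<beta>" using \<beta> by (intro mono_onD[OF assms(2)]) auto
    then show "F \<alpha> < c" using \<beta> by simp
  qed (use \<beta> in auto)
qed

theorem theorem2:
  fixes \<gamma> :: real
  assumes "\<gamma> > 1"
  shows "\<exists>C>0. \<forall>(T::real) \<rho> u \<rho>0 u0 (m::real) V F.
     0 < T \<longrightarrow> entropy_admissible \<gamma> T \<rho> u \<rho>0 u0 \<longrightarrow>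
     Linf_norm (slab T) (\<lambda>z. inverse (\<rho> z)) < \<infinity> \<longrightarrow>
     0 < m \<longrightarrow>
     Linf_norm (slab T) (\<lambda>z. inverse (\<rho> z) * (\<rho> z - 1)) + Linf_norm (slab T) u \<le> ennreal m \<longrightarrow>
     V \<noteq> {} \<longrightarrow> closed V \<longrightarrow> bounded V \<longrightarrow> lipschitz_boundary V \<longrightarrow>
     F = disturbance T \<rho> u \<rho>0 u0 V \<longrightarrow>
       (\<exists>B::real. \<forall>\<alpha>\<in>{0<..1}. F \<alpha> \<le> ennreal B) \<and>
       mono_on {0<..1} F \<and>
       (\<forall>\<alpha>\<in>{0<..1}. continuous (at_left \<alpha>) F) \<and>
       (F 0 = 0 \<longrightarrow>
          vanishing_speed F \<ge> inverse (1 + C * m) \<and>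
          (vanishing_speed F < 1 \<longrightarrow>
             (\<exists>l. (F \<longlongrightarrow> l) (at_right (vanishing_speed F)) \<and> l > 0 \<and>
                  (\<forall>\<alpha>. vanishing_speed F < \<alpha> \<and> \<alpha> \<le> 1 \<longrightarrow> F \<alpha> \<ge> l))) \<and>
          (\<forall>\<alpha>. 0 < \<alpha> \<and> \<alpha> \<le> 1 \<longrightarrow>
             has_continuous_representative (cone_region T V \<alpha>) (\<lambda>z. (\<rho> z, u z)) \<longrightarrow>
             (AE z in lebesgue_on (cone_region T V \<alpha>). (\<rho> z - 1, u z) = (0, 0))))"
proof -
  obtain C where C: "C > 0" "\<And>r v. r > 0 \<Longrightarrow>
      norm (rel_flux \<gamma> r v) \<le> (1 + C * (\<bar>inverse r * (r - 1)\<bar> + norm v)) * rel_energy \<gamma> r v"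
    using rel_flux_le_rel_energy[OF assms] by blast
  show ?thesis
  proof (intro exI[of _ C] conjI C(1), (intro allI impI)+)
    fix T :: real and \<rho> u \<rho>0 u0 and m :: real and V F
    assume T: "0 < T" and adm: "entropy_admissible \<gamma> T \<rho> u \<rho>0 u0" and m: "0 < m"
      and le_m: "Linf_norm (slab T) (\<lambda>z. inverse (\<rho> z) * (\<rho> z - 1)) + Linf_norm (slab T) u \<le> ennreal m"
      and V: "closed V" and F: "F = disturbance T \<rho> u \<rho>0 u0 V"
    have w: "weak_solution \<gamma> T \<rho> u \<rho>0 u0" using adm by (simp add: entropy_admissible_def)
    note meas = weak_solution_regularity[OF w]
    have F_eq: "F \<alpha> = Linf_norm (cone_region T V \<alpha>) (\<lambda>z. inverse (\<rho> z) * (\<rho> z - 1)) + Linf_norm (cone_region T V \<alpha>) u"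
      if "\<alpha> > 0" for \<alpha>
      using that by (simp add: F disturbance_pos_eq)
    have bound: "F \<alpha> \<le> ennreal m" if "\<alpha> > 0" for \<alpha>
    proof -
      have "F \<alpha> \<le> Linf_norm (slab T) (\<lambda>z. inverse (\<rho> z) * (\<rho> z - 1)) + Linf_norm (slab T) u"
        unfolding F_eq[OF that] using meas
        by (intro add_mono Linf_norm_mono cone_region_subset_slab cone_region_lebesgue slab_lebesgue)
      then show ?thesis using le_m by (rule order_trans)
    qed
    have mono: "F \<alpha> \<le> F \<alpha>'" if "0 < \<alpha>" "\<alpha> \<le> \<alpha>'" for \<alpha> \<alpha>'
      using that meas by (simp add: F_eq add_mono Linf_norm_cone_region_mono)
    have left_cont: "continuous (at_left \<alpha>) F" if \<alpha>: "\<alpha> > 0" for \<alpha>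
    proof -
      have "((\<lambda>\<alpha>. Linf_norm (cone_region T V \<alpha>) (\<lambda>z. inverse (\<rho> z) * (\<rho> z - 1)) + Linf_norm (cone_region T V \<alpha>) u)
          \<longlongrightarrow> F \<alpha>) (at_left \<alpha>)"
        unfolding F_eq[OF \<alpha>]
        by (intro tendsto_intros Linf_norm_cone_region_left_continuous meas \<alpha>)
      moreover have "\<forall>\<^sub>F \<alpha>' in at_left \<alpha>. F \<alpha>' = Linf_norm (cone_region T V \<alpha>') (\<lambda>z. inverse (\<rho> z) * (\<rho> z - 1))
          + Linf_norm (cone_region T V \<alpha>') u"
        unfolding eventually_at_left_field using \<alpha> F_eq by blast
      ultimately show ?thesis
        unfolding continuous_within by (simp add: tendsto_cong)
    qed
    have m_AE: "AE z in lebesgue. z \<in> slab T \<longrightarrow> \<bar>inverse (\<rho> z) * (\<rho> z - 1)\<bar> + norm (u z) \<le> m"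
      using AE_le_of_Linf_norm_add_le[OF slab_lebesgue le_m] m by simp
    let ?a = "vanishing_speed F"
    let ?S = "{\<alpha>. 0 \<le> \<alpha> \<and> \<alpha> \<le> 1 \<and> F \<alpha> = 0}"
    have S_bdd: "bdd_above ?S" by (rule bdd_aboveI[of _ 1]) auto
    have zeros: "\<alpha> \<le> ?a" if "0 \<le> \<alpha>" "\<alpha> \<le> 1" "F \<alpha> = 0" for \<alpha>
      unfolding vanishing_speed_def using that by (intro cSup_upper S_bdd) auto
    have small: "F \<alpha> = 0" if "F 0 = 0" "\<alpha> > 0" "F \<alpha> \<le> ennreal \<epsilon>" "\<epsilon> \<ge> 0" "\<alpha> * (1 + C * \<epsilon>) < 1" for \<alpha> \<epsilon>
      using region_vanishes_if_small[OF assms adm C V _ that(2) _ that(4,5)] that(1,3)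
      unfolding F by (intro disturbance_eq_0[OF w that(2)]) auto
    have speed: "?a \<ge> inverse (1 + C * m)" if F0: "F 0 = 0"
    proof (rule dense_le_bounded)
      have Cm: "1 + C * m > 1" using C m by simp
      then show "0 < inverse (1 + C * m)" by simp
      fix \<alpha> assume \<alpha>: "0 < \<alpha>" "\<alpha> < inverse (1 + C * m)"
      have "inverse (1 + C * m) < 1" using Cm by (simp add: inverse_less_1_iff)
      then have "\<alpha> \<le> 1" using \<alpha> by linarith
      moreover have "\<alpha> * (1 + C * m) < 1" using \<alpha> Cm by (simp add: field_simps)
      then have "F \<alpha> = 0" using small[OF F0 \<alpha>(1) bound[OF \<alpha>(1)]] m by simp
      ultimately show "\<alpha> \<le> ?a" using zeros \<alpha> by simp
    qed
    have jump: "\<exists>l. (F \<longlongrightarrow> l) (at_right ?a) \<and> l > 0 \<and> (\<forall>\<alpha>. ?a < \<alpha> \<and> \<alpha> \<le> 1 \<longrightarrow> F \<alpha> \<ge> l)"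
      if F0: "F 0 = 0" and less: "?a < 1"
    proof -
      define l where "l = (INF \<alpha>\<in>{?a<..1}. F \<alpha>)"
      have a: "?a > 0"
      proof -
        have "inverse (1 + C * m) > 0" using C m by (simp add: add_pos_pos)
        then show ?thesis using speed[OF F0] by linarith
      qed
      have "mono_on {?a<..1} F" using mono a by (auto intro!: mono_onI)
      then have lim: "(F \<longlongrightarrow> l) (at_right ?a)" unfolding l_def by (rule mono_tendsto_INF_at_right[OF less])
      have "l \<noteq> 0"
      proof
        assume l: "l = 0"
        \<comment> \<open>a speed strictly between \<open>a\<close> and 1, with an \<open>\<epsilon>\<close> small enough for it\<close>
        define b where "b = (?a + 1) / 2"
        have b: "?a < b" "b < 1" "b > 0" using less a by (auto simp: b_def)
        define \<epsilon> where "\<epsilon> = (1 / b - 1) / (2 * C)"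
        have "1 / b > 1" using b by simp
        then have \<epsilon>: "\<epsilon> > 0" using C by (simp add: \<epsilon>_def)
        have "b * (1 + C * \<epsilon>) = (b + 1) / 2" using C b by (simp add: \<epsilon>_def field_simps)
        then have b\<epsilon>: "b * (1 + C * \<epsilon>) < 1" using b by simp
        have "(INF \<alpha>\<in>{?a<..1}. F \<alpha>) < ennreal \<epsilon>" using l \<epsilon> by (simp add: l_def)
        then obtain \<alpha> where \<alpha>: "?a < \<alpha>" "\<alpha> \<le> 1" "F \<alpha> < ennreal \<epsilon>" unfolding INF_less_iff by auto
        define \<alpha>' where "\<alpha>' = min \<alpha> b"
        have \<alpha>': "?a < \<alpha>'" "\<alpha>' \<le> b" "\<alpha>' \<le> \<alpha>" "\<alpha>' \<le> 1" using \<alpha> b by (auto simp: \<alpha>'_def)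
        then have pos: "\<alpha>' > 0" using a by linarith
        have "F \<alpha>' \<le> ennreal \<epsilon>" using mono[OF pos \<alpha>'(3)] \<alpha>(3) by (meson less_imp_le order_trans)
        moreover have "\<alpha>' * (1 + C * \<epsilon>) \<le> b * (1 + C * \<epsilon>)"
          using \<alpha>' C \<epsilon> by (intro mult_right_mono) auto
        ultimately have "F \<alpha>' = 0" using small[OF F0 pos, of \<epsilon>] \<epsilon> b\<epsilon> by linarith
        then have "\<alpha>' \<le> ?a" using zeros pos \<alpha>' by simp
        then show False using \<alpha>' by simp
      qed
      then have "l > 0" by (simp add: zero_less_iff_neq_zero)
      moreover have "F \<alpha> \<ge> l" if "?a < \<alpha>" "\<alpha> \<le> 1" for \<alpha>
        unfolding l_def using that by (intro INF_lower) auto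
      ultimately show ?thesis using lim by blast
    qed
    have cont: "AE z in lebesgue_on (cone_region T V \<alpha>). (\<rho> z - 1, u z) = (0, 0)"
      if F0: "F 0 = 0" and \<alpha>: "0 < \<alpha>" "\<alpha> \<le> 1"
        and rep: "has_continuous_representative (cone_region T V \<alpha>) (\<lambda>z. (\<rho> z, u z))" for \<alpha>
      using continuous_region_vanishes[OF assms adm C m m_AE initial_rest_state[OF w V F0[unfolded F]] \<alpha> rep]
      by (auto simp: AE_lebesgue_on elim!: eventually_mono)
    show "(\<exists>B::real. \<forall>\<alpha>\<in>{0<..1}. F \<alpha> \<le> ennreal B) \<and>
       mono_on {0<..1} F \<and>
       (\<forall>\<alpha>\<in>{0<..1}. continuous (at_left \<alpha>) F) \<and>
       (F 0 = 0 \<longrightarrow>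
          vanishing_speed F \<ge> inverse (1 + C * m) \<and>
          (vanishing_speed F < 1 \<longrightarrow>
             (\<exists>l. (F \<longlongrightarrow> l) (at_right (vanishing_speed F)) \<and> l > 0 \<and>
                  (\<forall>\<alpha>. vanishing_speed F < \<alpha> \<and> \<alpha> \<le> 1 \<longrightarrow> F \<alpha> \<ge> l))) \<and>
          (\<forall>\<alpha>. 0 < \<alpha> \<and> \<alpha> \<le> 1 \<longrightarrow>
             has_continuous_representative (cone_region T V \<alpha>) (\<lambda>z. (\<rho> z, u z)) \<longrightarrow>
             (AE z in lebesgue_on (cone_region T V \<alpha>). (\<rho> z - 1, u z) = (0, 0))))"
    proof (intro conjI impI)
      show "\<exists>B::real. \<forall>\<alpha>\<in>{0<..1}. F \<alpha> \<le> ennreal B" using bound by (intro exI[of _ m]) simp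
      show "mono_on {0<..1} F" using mono by (auto intro!: mono_onI)
      show "\<forall>\<alpha>\<in>{0<..1}. continuous (at_left \<alpha>) F" using left_cont by simp
    qed (use speed jump cont in blast)+
  qed
qed

end
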